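(* (1) Let $\mu$ be a Borel probability measure on $\mathbb{R}$ for which there is a connected open set $\mathcal{D}$ with $\mathbb{C}^+ \subset\mathcal{D} \subset \mathbb{C}$ such that: (A1) $G_\mu$ extends to a meromorphic function in $\mathcal{D}$ (still denoted $G_\mu$); (A2) if $z \in \mathcal{D}$ and $G_\mu(z) \in \mathbb{C}^-$, then $G_\mu'(z)\neq 0$; (A3) if a sequence $(z_n)_{n \geq 1} \subset \mathcal{D}$ converges to a point of $\partial \mathcal{D} \cup \{\infty\}$, then the limit $\lim_{n\to \infty} G_\mu(z_n)$ exists in $\mathbb{C}^{+} \cup \mathbb{R} \cup \{\infty\}$. Then $\mu \in \mathcal{UI}$. (2) Let $\mu$ be a symmetric Borel probability measure on $\mathbb{R}$ satisfying the following condition (B): there is $c \leq 0$ such that $G_\mu$ extends to a univalent map around $i(c,\infty)$ and maps $i(c,\infty)$ onto $i(-\infty,0)$; moreover, there is a connected open set $\mathcal{D}$ with $\mathbb{C}^+ \cap \mathbb{H}^+ \subset \mathcal{D} \subset \mathbb{C}^- \cup \mathbb{H}^+$ such that: (B1) $G_\mu$ extends to a meromorphic function in $\mathcal{D}$ (still denoted $G_\mu$); (B2) if $z \in \mathcal{D}$ and $G_\mu(z) \in \mathbb{C}^-$, then $G_\mu'(z)\neq 0$; (B3) if a sequence $(z_n)_{n \geq 1} \subset \mathcal{D}$ converges to a point of $\partial \mathcal{D} \cup \{\infty\}$, then the limit $\lim_{n\to \infty} G_{\mu}(z_n)$ exists in $\overline{\mathbb{H}^- \cup \mathbb{C}^+}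 \cup \{\infty\}$. Then $\mu \in \mathcal{UI}_s$. If, moreover, the domain $\mathcal{D}$ can be taken as a subset of $\mathbb{H}^+$, then $\mu \in \mathcal{UI}$.
   Context: $\mathbb{C}^+,\mathbb{C}^-,\mathbb{H}^+,\mathbb{H}^-$ are the open upper, lower, right and left half-planes. $G_\mu(z)=\int_{\mathbb{R}}\frac{1}{z-x}\mu(dx)$ and $F_\mu(z)=1/G_\mu(z)$ for $z\in\mathbb{C}^+$. "Univalent around $i(c,\infty)$" means analytic and injective in an open neighborhood of $i(c,\infty)=\{iy:y>c\}$. In (2), the extension to $\mathcal{D}$ is that of the restriction of $G_\mu$ to $\mathbb{C}^+\cap\mathbb{H}^+=\mathcal{D}\cap\mathbb{C}^+$. For $\lambda,M>0$ put $\Gamma_{\lambda,M}=\{z\in\mathbb{C}^+: \mathrm{Im}\,z>M,\ |\mathrm{Re}\,z|<\lambda\,\mathrm{Im}\,z\}$. For each $\lambda>0$ there is $M>0$ such that $F_\mu$ is univalent on $\Gamma_{\lambda,M}$ and has a right compositional inverse $F_\mu^{-1}$ on $\Gamma_{\lambda,M}$ (inverting the restriction of $F_\mu$ to a truncated cone of the same type where it is univalent); below $\Gamma_{\lambda,M}$ denotes such a cone. $\mu\in\mathcal{UI}$ means: $F_\mu^{-1}$, defined in some $\Gamma_{\lambda,M}$, analytically extends to a univalent map in $\mathbb{C}^+$. A symmetric probability measure $\mu$ is in $\mathcal{UI}_s$ if: (a) there is $c \leq 0$ such that $F_\mu$ extends to a univalent map around $i(c,\infty)$ and maps $i(c,\infty)$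 onto $i(0,\infty)$; (b) there is an open set $\widetilde{\Omega} \subset \mathbb{C}^-\cup \mathbb{H}^+$ such that $\widetilde{\Omega} \cap \Gamma_{\lambda,M} \neq \emptyset$ and $F_\mu$ extends to an analytic bijection of $\widetilde{\Omega}$ onto $\mathbb{C}^+ \cap \mathbb{H}^+$. *)

theory Defs
  imports "HOL-Complex_Analysis.Complex_Analysis" "HOL-Probability.Probability"
begin

abbreviation upper_half :: "complex set" where "upper_half \<equiv> {z. Im z > 0}"
abbreviation lower_half :: "complex set" where "lower_half \<equiv> {z. Im z < 0}"
abbreviation right_half :: "complex set" where "right_half \<equiv> {z. Re z > 0}"
abbreviation left_half :: "complex set" where "left_half \<equiv> {z. Re z < 0}"

definition imag_segment :: "real set \<Rightarrow> complex set" where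
  "imag_segment I = (\<lambda>y. \<i> * complex_of_real y) ` I"

definition univalent_on :: "(complex \<Rightarrow> complex) \<Rightarrow> complex set \<Rightarrow> bool" where
  "univalent_on f S \<longleftrightarrow> f holomorphic_on S \<and> inj_on f S"

(* Only the values on upper_half are meaningful for the two transforms; every use below
   restricts to it. *)
definition cauchy_transform :: "real measure \<Rightarrow> complex \<Rightarrow> complex" where
  "cauchy_transform \<mu> z = (LINT x|\<mu>. 1 / (z - complex_of_real x))"

definition F_transform :: "real measure \<Rightarrow> complex \<Rightarrow> complex" where
  "F_transform \<mu> z = 1 / cauchy_transform \<mu> z"

definition symmetric_measure :: "real measure \<Rightarrow> bool" where
  "symmetric_measure \<mu> \<longleftrightarrow> distr \<mu> borel uminus = \<mu>"

definition trunc_cone :: "real \<Rightarrow> real \<Rightarrow> complex set" where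
  "trunc_cone a M = {z. Im z > 0 \<and> Im z > M \<and> \<bar>Re z\<bar> < a * Im z}"

(* h is (a version of) the right inverse of F_transform \<mu> on the cone with parameters a, M,
   taking its values in a second truncated cone on which F_transform \<mu> is univalent. *)
definition F_inverse_on_cone ::
    "real measure \<Rightarrow> real \<Rightarrow> real \<Rightarrow> (complex \<Rightarrow> complex) \<Rightarrow> bool" where
  "F_inverse_on_cone \<mu> a M h \<longleftrightarrow>
     a > 0 \<and> M > 0 \<and> univalent_on (F_transform \<mu>) (trunc_cone a M) \<and>
     (\<exists>a'>0. \<exists>M'>0. univalent_on (F_transform \<mu>) (trunc_cone a' M') \<and>
        (\<forall>z\<in>trunc_cone a M. h z \<in> trunc_cone a' M' \<and> F_transform \<mu> (h z) = z))"

definition UI :: "real measure \<Rightarrow> bool" where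
  "UI \<mu> \<longleftrightarrow>
     (\<exists>a M h g. F_inverse_on_cone \<mu> a M h \<and>
        univalent_on g upper_half \<and> (\<forall>z\<in>trunc_cone a M. g z = h z))"

(* f, given on the upper half-plane, extends to a univalent map around i(c,oo) that maps
   i(c,oo) onto A. *)
definition univalent_around_axis_onto ::
    "(complex \<Rightarrow> complex) \<Rightarrow> real \<Rightarrow> complex set \<Rightarrow> bool" where
  "univalent_around_axis_onto f c A \<longleftrightarrow>
     (\<exists>U g. open U \<and> imag_segment {c<..} \<subseteq> U \<and> univalent_on g U \<and>
        (\<forall>z\<in>U \<inter> upper_half. g z = f z) \<and> g ` imag_segment {c<..} = A)"

definition UIs :: "real measure \<Rightarrow> bool" where
  "UIs \<mu> \<longleftrightarrow> symmetric_measure \<mu> \<and>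
     (\<exists>c\<le>0. univalent_around_axis_onto (F_transform \<mu>) c (imag_segment {0<..})) \<and>
     (\<exists>\<Omega> f. open \<Omega> \<and> \<Omega> \<subseteq> lower_half \<union> right_half \<and>
        (\<exists>a M h. F_inverse_on_cone \<mu> a M h \<and> \<Omega> \<inter> trunc_cone a M \<noteq> {}) \<and>
        f holomorphic_on \<Omega> \<and> (\<forall>z\<in>\<Omega> \<inter> upper_half. f z = F_transform \<mu> z) \<and>
        bij_betw f \<Omega> (upper_half \<inter> right_half))"

(* None is the point at infinity. *)
abbreviation riemann_sphere :: "complex option topology" where
  "riemann_sphere \<equiv> Alexandroff_compactification euclidean"

(* A nicely meromorphic function has the HOL value 0 at its poles; this restores the value
   infinity there, so that limits may also be taken along sequences that hit poles. *)
definition sphere_value :: "(complex \<Rightarrow> complex) \<Rightarrow> complex \<Rightarrow> complex option" where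
  "sphere_value G z = (if is_pole G z then None else Some (G z))"

definition boundary_limits_in ::
    "(complex \<Rightarrow> complex) \<Rightarrow> complex set \<Rightarrow> complex option set \<Rightarrow> bool" where
  "boundary_limits_in G D L \<longleftrightarrow>
     (\<forall>z p. (\<forall>n::nat. z n \<in> D) \<and> p \<in> insert None (Some ` frontier D) \<and>
            limitin riemann_sphere (\<lambda>n. Some (z n)) p sequentially \<longrightarrow>
        (\<exists>l\<in>L. limitin riemann_sphere (\<lambda>n. sphere_value G (z n)) l sequentially))"

definition condition_A :: "real measure \<Rightarrow> complex set \<Rightarrow> bool" where
  "condition_A \<mu> D \<longleftrightarrow> open D \<and> connected D \<and> upper_half \<subseteq> D \<and>
     (\<exists>G. G nicely_meromorphic_on D \<and> (\<forall>z\<in>upper_half. G z = cauchy_transform \<mu> z) \<and>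
        (\<forall>z\<in>D. G z \<in> lower_half \<longrightarrow> deriv G z \<noteq> 0) \<and>
        boundary_limits_in G D (insert None (Some ` (upper_half \<union> \<real>))))"

definition condition_B_axis :: "real measure \<Rightarrow> bool" where
  "condition_B_axis \<mu> \<longleftrightarrow>
     (\<exists>c\<le>0. univalent_around_axis_onto (cauchy_transform \<mu>) c (imag_segment {..<0}))"

definition condition_B_domain :: "real measure \<Rightarrow> complex set \<Rightarrow> bool" where
  "condition_B_domain \<mu> D \<longleftrightarrow> open D \<and> connected D \<and>
     upper_half \<inter> right_half \<subseteq> D \<and> D \<subseteq> lower_half \<union> right_half \<and>
     (\<exists>G. G nicely_meromorphic_on D \<and>
        (\<forall>z\<in>upper_half \<inter> right_half. G z = cauchy_transform \<mu> z) \<and>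
        (\<forall>z\<in>D. G z \<in> lower_half \<longrightarrow> deriv G z \<noteq> 0) \<and>
        boundary_limits_in G D (insert None (Some ` closure (left_half \<union> upper_half))))"

end

theory Submission
  imports Defs
begin

text \<open>
  Let \<open>T\<close> be the lower half-plane in (1) and the open fourth quadrant in (2). The boundary condition
  says that no point of \<open>T\<close> is a limit of \<open>G\<close> along a sequence leaving the domain, so \<open>G\<close> restricted
  to the preimage of \<open>T\<close> is proper, and it is a local homeomorphism by the condition on \<open>G'\<close>. A
  proper local homeomorphism onto a connected set is a covering, and \<open>T\<close> is simply connected, so the
  germ of \<open>G\<^sup>-\<^sup>1\<close> at a point \<open>G z\<^sub>0\<close> extends to a section \<open>s\<close> over \<open>T\<close>; then \<open>F\<^sup>-\<^sup>1\<close> extends to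
  \<open>z \<mapsto> s (1/z)\<close>.

  When the domain in (2) lies in the right half-plane, \<open>s\<close> agrees near the negative imaginary axis with
  the inverse \<open>k\<close> of the univalent continuation of \<open>G\<close> along the axis. Hence \<open>s\<close> extends continuously
  to the axis with imaginary values, and Schwarz reflection continues it to the lower half-plane. The
  result is injective because the right quadrant, the axis and the left quadrant go to the right
  half-plane, the axis and the left half-plane.
\<close>

subsection \<open>Covering maps from boundary limits\<close>

text \<open>The part of the preimage of a closed disc that lies off \<open>N\<close> is compact, so
  its image is closed. That image misses \<open>x\<close>, hence a small disc around
  \<open>x\<close> avoids it.\<close>

lemma proper_imp_fibre_neighbourhood:
  fixes p :: "complex \<Rightarrow> complex"
  assumes p: "continuous_on C p" and "open S" "x \<in> S" "open N"
    and N: "{z\<in>C. p z = x} \<subseteq> N"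
    and proper: "\<And>K. compact K \<Longrightarrow> K \<subseteq> S \<Longrightarrow> compact {z\<in>C. p z \<in> K}"
  obtains e where "e > 0" "ball x e \<subseteq> S" "{z\<in>C. p z \<in> ball x e} \<subseteq> N"
proof -
  obtain d where d: "d > 0" "cball x d \<subseteq> S"
    using \<open>open S\<close> \<open>x \<in> S\<close> open_contains_cball by blast
  define R where "R = p ` ({z\<in>C. p z \<in> cball x d} - N)"
  have "compact ({z\<in>C. p z \<in> cball x d} - N)"
    using proper[OF compact_cball d(2)] \<open>open N\<close> by (rule compact_diff)
  then have "compact R"
    unfolding R_def by (intro compact_continuous_image continuous_on_subset[OF p]) auto
  moreover have "x \<notin> R"
    using N by (auto simp: R_def)
  ultimately have "open (- R)" "x \<in> - R"
    by (auto simp: compact_imp_closed)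
  then obtain e where e: "e > 0" "ball x e \<subseteq> - R"
    using open_contains_ball by blast
  show ?thesis
  proof
    show "min d e > 0" using d e by simp
    show "ball x (min d e) \<subseteq> S" using d by auto
    show "{z\<in>C. p z \<in> ball x (min d e)} \<subseteq> N"
      using e(2) by (force simp: R_def)
  qed
qed

text \<open>Properness makes the fibres finite and confines the preimage of a small disc to
  disjoint discs around the points of the fibre.\<close>

lemma proper_imp_covering_space:
  fixes p :: "complex \<Rightarrow> complex"
  assumes C: "open C" "C \<noteq> {}" and S: "open S" "connected S"
    and holp: "p holomorphic_on C" and pS: "p ` C \<subseteq> S"
    and p': "\<And>z. z \<in> C \<Longrightarrow> deriv p z \<noteq> 0"
    and proper: "\<And>K. compact K \<Longrightarrow> K \<subseteq> S \<Longrightarrow> compact {z\<in>C. p z \<in> K}"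
  shows "covering_space C p S"
proof
  show contp: "continuous_on C p"
    using holp by (rule holomorphic_on_imp_continuous_on)
  have loc: "\<exists>r>0. ball z r \<subseteq> C \<and> inj_on p (ball z r)" if "z \<in> C" for z
    using has_complex_derivative_locally_injective[OF holp that \<open>open C\<close> p'[OF that]] by metis
  have "open (p ` C)"
  proof (subst open_subopen, intro ballI)
    fix y assume "y \<in> p ` C"
    then obtain z where z: "z \<in> C" "y = p z" by blast
    from loc[OF z(1)] obtain r where r: "r > 0" "ball z r \<subseteq> C" "inj_on p (ball z r)" by blast
    then have "open (p ` ball z r)"
      by (intro open_mapping_thm3 holomorphic_on_subset[OF holp]) auto
    then show "\<exists>T. open T \<and> y \<in> T \<and> T \<subseteq> p ` C"
      using r z by (intro exI[of _ "p ` ball z r"]) auto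
  qed
  \<comment> \<open>The fibre lemma with \<open>N\<close> empty: a value that is not attained has a
    whole disc of such values. The image is then open and closed in the connected set
    \<open>S\<close>.\<close>
  moreover have "open (S - p ` C)"
  proof (subst open_subopen, intro ballI)
    fix x assume "x \<in> S - p ` C"
    then obtain e where "e > 0" "ball x e \<subseteq> S" "{z\<in>C. p z \<in> ball x e} \<subseteq> {}"
      using proper_imp_fibre_neighbourhood[OF contp S(1) _ open_empty _ proper, of x] by blast
    then show "\<exists>T. open T \<and> x \<in> T \<and> T \<subseteq> S - p ` C"
      by (intro exI[of _ "ball x e"]) auto
  qed
  ultimately show "p ` C = S"
    using connectedD[OF S(2), of "p ` C" "S - p ` C"] C(2) pS by auto
  fix x assume "x \<in> S"
  define Z where "Z = {z\<in>C. p z = x}"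
  obtain r where r: "\<And>z. z \<in> C \<Longrightarrow> r z > 0 \<and> ball z (r z) \<subseteq> C \<and> inj_on p (ball z (r z))"
    using loc by metis
  have "compact Z"
    using proper[of "{x}"] \<open>x \<in> S\<close> by (simp add: Z_def)
  moreover have "Z \<subseteq> \<Union>((\<lambda>z. ball z (r z)) ` Z)"
    using r by (force simp: Z_def)
  ultimately obtain Z' where Z': "Z' \<subseteq> Z" "finite Z'" "Z \<subseteq> \<Union>((\<lambda>z. ball z (r z)) ` Z')"
    using compactE_image[of Z Z "\<lambda>z. ball z (r z)"] by (metis open_ball)
  \<comment> \<open>\<open>p\<close> is injective on each chosen disc, so the disc around
    \<open>z'\<close> contains no fibre point other than \<open>z'\<close>.\<close>
  have "Z \<subseteq> Z'"
  proof
    fix z assume "z \<in> Z"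
    then obtain z' where "z' \<in> Z'" "z \<in> ball z' (r z')" using Z'(3) by blast
    moreover have "inj_on p (ball z' (r z'))" "z' \<in> ball z' (r z')" "p z = p z'"
      using r[of z'] Z' \<open>z' \<in> Z'\<close> \<open>z \<in> Z\<close> by (auto simp: Z_def)
    ultimately show "z \<in> Z'" by (metis inj_onD)
  qed
  then have finZ: "finite Z" using Z'(2) finite_subset by blast
  obtain d where d: "d > 0" "\<And>z z'. z \<in> Z \<Longrightarrow> z' \<in> Z \<Longrightarrow> z \<noteq> z' \<Longrightarrow> d \<le> dist z z'"
  proof -
    have "\<exists>d>0. \<forall>z\<in>Z. \<forall>z'\<in>Z. z \<noteq> z' \<longrightarrow> d \<le> dist z z'"
    proof -
      \<comment> \<open>The extra element 1 keeps the set nonempty, so that \<open>Min\<close> is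
        meaningful for a fibre with at most one point.\<close>
      define E where "E = insert 1 ((\<lambda>(z,z'). dist z z') ` {(z,z')\<in>Z\<times>Z. z \<noteq> z'})"
      have "finite {(z,z')\<in>Z\<times>Z. z \<noteq> z'}"
        by (rule finite_subset[of _ "Z\<times>Z"]) (use finZ in auto)
      then have E: "finite E" by (simp add: E_def)
      have "Min E > 0" using E by (subst Min_gr_iff) (auto simp: E_def)
      moreover have "Min E \<le> dist z z'" if "z \<in> Z" "z' \<in> Z" "z \<noteq> z'" for z z'
        using that E by (intro Min_le) (auto simp: E_def)
      ultimately show ?thesis by blast
    qed
    then show ?thesis using that by blast
  qed
  \<comment> \<open>Radius at most \<open>d/2\<close> separates the discs; radius at most
    \<open>r z\<close> keeps \<open>p\<close> injective on them.\<close>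
  define B where "B z = ball z (min (r z) (d/2))" for z
  have ZC: "Z \<subseteq> C" by (auto simp: Z_def)
  have B: "z \<in> B z" "open (B z)" "B z \<subseteq> C" "inj_on p (B z)" if "z \<in> Z" for z
  proof -
    have rz: "r z > 0" "ball z (r z) \<subseteq> C" "inj_on p (ball z (r z))" using r that ZC by auto
    then show "z \<in> B z" "open (B z)" "B z \<subseteq> C" using d(1) by (auto simp: B_def)
    show "inj_on p (B z)"
      by (rule inj_on_subset[of _ "ball z (r z)"]) (use rz in \<open>auto simp: B_def\<close>)
  qed
  have disj: "B z \<inter> B z' = {}" if "z \<in> Z" "z' \<in> Z" "z \<noteq> z'" for z z'
    using d(2)[OF that] dist_triangle_half_r[of _ z d z'] unfolding B_def disjoint_iff
    by (auto simp: dist_commute) 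
  have "open (\<Union>z\<in>Z. B z)" using B by blast
  moreover have "{z\<in>C. p z = x} \<subseteq> (\<Union>z\<in>Z. B z)" using B by (auto simp: Z_def)
  ultimately obtain e where e: "e > 0" "ball x e \<subseteq> S" "{z\<in>C. p z \<in> ball x e} \<subseteq> (\<Union>z\<in>Z. B z)"
    by (rule proper_imp_fibre_neighbourhood[OF contp S(1) \<open>x \<in> S\<close> _ _ proper])
  \<comment> \<open>Over the disc of radius \<open>e\<close> there are no preimages outside the
    discs \<open>B z\<close>; intersecting with their images makes every sheet cover all of
    \<open>T\<close>.\<close>
  define T where "T = ball x e \<inter> (\<Inter>z\<in>Z. p ` B z)"
  have opB: "open (p ` B z)" if "z \<in> Z" for z
    using B[OF that] by (intro open_mapping_thm3 holomorphic_on_subset[OF holp])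
  have T: "open T" "x \<in> T" "T \<subseteq> S"
  proof -
    show "open T" unfolding T_def using finZ opB by (intro open_Int open_INT) auto
    show "x \<in> T" using e(1) B by (force simp: T_def Z_def)
    show "T \<subseteq> S" using e by (auto simp: T_def)
  qed
  define V where "V z = B z \<inter> p -` T" for z
  have V: "open (V z)" "V z \<subseteq> C" "p ` V z = T" if "z \<in> Z" for z
  proof -
    show "open (V z)" unfolding V_def
      using B[OF that] T(1) by (intro continuous_open_preimage continuous_on_subset[OF contp]) auto
    show "V z \<subseteq> C" using B[OF that] by (auto simp: V_def)
    have "T \<subseteq> p ` B z" using that by (auto simp: T_def)
    then show "p ` V z = T" by (force simp: V_def)
  qed
  show "\<exists>T. x \<in> T \<and> openin (top_of_set S) T \<and>
            (\<exists>v. \<Union> v = C \<inter> p -` T \<and> (\<forall>u\<in>v. openin (top_of_set C) u) \<and>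
                 pairwise disjnt v \<and> (\<forall>u\<in>v. \<exists>q. homeomorphism u T p q))"
  proof (intro exI[of _ T] conjI exI[of _ "V ` Z"])
    show "openin (top_of_set S) T" using T by (simp add: open_subset)
    show "\<Union> (V ` Z) = C \<inter> p -` T"
    proof
      show "\<Union> (V ` Z) \<subseteq> C \<inter> p -` T" using V(2) by (auto simp: V_def)
      show "C \<inter> p -` T \<subseteq> \<Union> (V ` Z)" using e(3) by (force simp: V_def T_def)
    qed
    show "\<forall>u\<in>V ` Z. openin (top_of_set C) u" using V by (auto intro: open_subset)
    show "pairwise disjnt (V ` Z)"
      using disj by (fastforce simp: pairwise_def disjnt_def V_def)
    show "\<forall>u\<in>V ` Z. \<exists>q. homeomorphism u T p q"
    proof
      fix u assume "u \<in> V ` Z"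
      then obtain z where z: "z \<in> Z" "u = V z" by blast
      have "inj_on p u" using B(4)[OF z(1)] z(2) by (auto simp: V_def intro: inj_on_subset)
      moreover have "open u" "continuous_on u p" "p ` u = T"
        using V[OF z(1)] z(2) continuous_on_subset[OF contp] by auto
      ultimately show "\<exists>q. homeomorphism u T p q"
        using invariance_of_domain_homeomorphism[of u p] by (metis order_refl)
    qed
  qed (use T in auto)
qed

section \<open>Limits on the Riemann sphere and properness of \<open>G\<close>\<close>

lemma limitin_riemann_sphere_Some:
  assumes "f \<longlonglongrightarrow> l"
  shows "limitin riemann_sphere (\<lambda>n. Some (f n)) (Some l) sequentially"
  unfolding limitin_def
proof (intro conjI allI impI)
  fix U assume U: "openin riemann_sphere U \<and> Some l \<in> U"
  then consider V where "open V" "U = Some ` V"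
    | K where "closed K" "U = insert None (Some ` (- K))"
    by (auto simp: openin_Alexandroff_compactification Compl_eq_Diff_UNIV)
  then have "open (Some -` U)"
  proof cases
    case 1
    then have "Some -` U = V" by auto
    then show ?thesis using 1 by simp
  next
    case 2
    then have "Some -` U = - K" by auto
    then show ?thesis using 2 by auto
  qed
  then have "\<forall>\<^sub>F n in sequentially. f n \<in> Some -` U"
    using assms U by (intro topological_tendstoD) auto
  then show "\<forall>\<^sub>F n in sequentially. Some (f n) \<in> U" by simp
qed auto

lemma limitin_riemann_sphere_None:
  assumes "filterlim f at_infinity sequentially"
  shows "limitin riemann_sphere (\<lambda>n. Some (f n)) None sequentially"
  unfolding limitin_def
proof (intro conjI allI impI)
  fix U assume "openin riemann_sphere U \<and> None \<in> U"
  then obtain K where K: "compact K" "U = insert None (Some ` (- K))"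
    by (auto simp: openin_Alexandroff_compactification Compl_eq_Diff_UNIV)
  obtain B where "B > 0" "\<forall>x\<in>K. norm x \<le> B"
    using compact_imp_bounded[OF K(1)] bounded_pos by blast
  then have sub: "Some z \<in> U" if "norm z > B" for z
    using that K(2) by (force simp: image_iff)
  have "\<forall>\<^sub>F n in sequentially. norm (f n) > B"
    using filterlim_at_infinity_imp_norm_at_top[OF assms] by (simp add: filterlim_at_top_dense)
  then show "\<forall>\<^sub>F n in sequentially. Some (f n) \<in> U"
    by (rule eventually_mono) (rule sub)
qed auto

text \<open>A sequence in the preimage of \<open>K\<close> cannot be unbounded or accumulate at the
  frontier of \<open>D\<close>, since its values would converge to a point of \<open>L\<close>,
  which misses \<open>K\<close>. So a subsequence converges inside \<open>D\<close>, and continuity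
  of \<open>G\<close> keeps the limit in the preimage.\<close>

lemma boundary_limits_imp_proper:
  assumes "open D" and G: "G nicely_meromorphic_on D" and bd: "boundary_limits_in G D L"
    and K: "compact K" "0 \<notin> K" "L \<inter> Some ` K = {}"
  shows "compact {z\<in>D. G z \<in> K}"
proof -
  \<comment> \<open>A nicely meromorphic function has the value 0 at its poles, so
    \<open>0 \<notin> K\<close> keeps poles out of the preimage and \<open>sphere_value\<close> is
    the plain value there.\<close>
  have np: "\<not> is_pole G z" if "z \<in> D" "G z \<in> K" for z
    using G that K(2) not_tendsto_and_filterlim_at_infinity[of "at z" G "G z"]
    by (auto simp: nicely_meromorphic_on_def is_pole_def)
  have key: False
    if f: "\<And>n. f n \<in> D" "\<And>n. G (f n) \<in> K" and p: "p \<in> insert None (Some ` frontier D)"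
      and lim: "limitin riemann_sphere (\<lambda>n. Some (f n)) p sequentially" for f p
  proof -
    obtain l where l: "l \<in> L" "limitin riemann_sphere (\<lambda>n. sphere_value G (f n)) l sequentially"
      using bd f(1) p lim unfolding boundary_limits_in_def by metis
    \<comment> \<open>The complement of \<open>K\<close>, with infinity added, is an open
      neighbourhood of every admissible limit, yet all values lie in \<open>K\<close>.\<close>
    have "openin riemann_sphere (insert None (Some ` (UNIV - K)))"
      using K(1) by (auto simp: openin_Alexandroff_compactification compact_imp_closed)
    moreover have "l \<in> insert None (Some ` (UNIV - K))"
      using l(1) K(3) by (cases l) auto
    ultimately have "\<forall>\<^sub>F n in sequentially. sphere_value G (f n) \<in> insert None (Some ` (UNIV - K))"
      using l(2) unfolding limitin_def by blast
    then obtain n where "sphere_value G (f n) \<in> insert None (Some ` (UNIV - K))"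
      using eventually_happens trivial_limit_sequentially by blast
    then show False
      using f np[OF f(1) f(2)] by (auto simp: sphere_value_def)
  qed
  show ?thesis
    unfolding compact_eq_seq_compact_metric seq_compact_def
  proof (intro allI impI)
    fix f :: "nat \<Rightarrow> complex" assume "\<forall>n. f n \<in> {z\<in>D. G z \<in> K}"
    then have f: "\<And>n. f n \<in> D" "\<And>n. G (f n) \<in> K" by auto
    have "bounded (range f)"
    proof (rule ccontr)
      assume "\<not> bounded (range f)"
      then have "\<forall>B. \<exists>n. norm (f n) > B"
        unfolding bounded_iff by (auto simp: not_le)
      then have "\<forall>n::nat. \<exists>m. norm (f m) > real n" by blast
      then obtain r where r: "\<And>n::nat. norm (f (r n)) > real n" by metis
      have "filterlim (\<lambda>n. norm (f (r n))) at_top sequentially"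
        by (rule filterlim_at_top_mono[OF filterlim_real_sequentially])
           (use r in \<open>auto intro!: always_eventually less_imp_le\<close>)
      then have "filterlim (\<lambda>n. f (r n)) at_infinity sequentially"
        by (rule filterlim_norm_at_top_imp_at_infinity)
      from key[OF _ _ _ limitin_riemann_sphere_None[OF this]] f show False by auto
    qed
    then obtain l r where r: "strict_mono r" "(f \<circ> r) \<longlonglongrightarrow> l"
      using bounded_imp_convergent_subsequence by blast
    have "l \<in> closure D"
      using closure_sequential f(1) r(2) by (metis comp_apply)
    moreover have "l \<notin> frontier D"
      using key[OF _ _ _ limitin_riemann_sphere_Some[OF r(2)]] f by auto
    ultimately have "l \<in> D"
      by (auto simp: frontier_def interior_open[OF \<open>open D\<close>])
    \<comment> \<open>At a pole the stored value 0 is not in \<open>K\<close>, so the sequence would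
      avoid \<open>l\<close> and its values would blow up, although \<open>K\<close> is
      bounded.\<close>
    have "\<not> is_pole G l"
    proof
      assume pole: "is_pole G l"
      then have "G l = 0"
        using G \<open>l \<in> D\<close> not_tendsto_and_filterlim_at_infinity[of "at l" G "G l"]
        by (auto simp: nicely_meromorphic_on_def is_pole_def)
      then have ne: "(f \<circ> r) n \<noteq> l" for n
        using f(2)[of "r n"] K(2) by auto
      then have "filterlim (f \<circ> r) (at l) sequentially"
        using r(2) by (auto simp: filterlim_at)
      then have "filterlim (\<lambda>n. G ((f \<circ> r) n)) at_infinity sequentially"
        using pole unfolding is_pole_def by (rule filterlim_compose[rotated])
      then have top: "filterlim (\<lambda>n. norm (G ((f \<circ> r) n))) at_top sequentially"
        by (rule filterlim_at_infinity_imp_norm_at_top)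
      obtain B where B: "\<And>x. x \<in> K \<Longrightarrow> norm x \<le> B"
        using compact_imp_bounded[OF K(1)] bounded_iff by blast
      have "\<forall>\<^sub>F n in sequentially. norm (G ((f \<circ> r) n)) > B"
        using top unfolding filterlim_at_top_dense by blast
      then obtain n where "norm (G ((f \<circ> r) n)) > B"
        using eventually_happens trivial_limit_sequentially by blast
      then show False
        using B[OF f(2), of "r n"] by simp
    qed
    then have "isCont G l"
      using nicely_meromorphic_on_imp_analytic_at[OF G \<open>l \<in> D\<close>] analytic_at_imp_isCont by blast
    then have "(\<lambda>n. G ((f \<circ> r) n)) \<longlonglongrightarrow> G l"
      using r(2) by (rule isCont_tendsto_compose)
    then have "G l \<in> K"
      using closed_sequentially[OF compact_imp_closed[OF K(1)]] f(2) by (metis comp_apply)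
    then show "\<exists>l\<in>{z \<in> D. G z \<in> K}. \<exists>r. strict_mono r \<and> (f \<circ> r) \<longlonglongrightarrow> l"
      using \<open>l \<in> D\<close> r by blast
  qed
qed

text \<open>Since \<open>0 \<notin> T\<close>, poles stay out of \<open>C\<close> and
  \<open>G\<close> is analytic there; compact subsets of \<open>T\<close> miss \<open>L\<close>,
  which gives properness. \<open>T\<close> is left abstract to serve both the half-plane and the
  quadrant.\<close>

lemma boundary_limits_imp_covering_space:
  assumes D: "open D" and G: "G nicely_meromorphic_on D" and bd: "boundary_limits_in G D L"
    and T: "open T" "connected T" "0 \<notin> T" "L \<inter> Some ` T = {}"
    and G': "\<And>z. z \<in> D \<Longrightarrow> G z \<in> T \<Longrightarrow> deriv G z \<noteq> 0"
    and z0: "z0 \<in> D" "G z0 \<in> T"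
  defines "C \<equiv> {z\<in>D. G z \<in> T}"
  shows "open C" "G holomorphic_on C" "covering_space C G T"
proof -
  have an: "G analytic_on {z}" if "z \<in> C" for z
  proof (rule nicely_meromorphic_on_imp_analytic_at[OF G])
    show "z \<in> D" using that by (simp add: C_def)
    show "\<not> is_pole G z"
      using G that T(3) not_tendsto_and_filterlim_at_infinity[of "at z" G "G z"]
      by (auto simp: nicely_meromorphic_on_def is_pole_def C_def)
  qed
  then have "G analytic_on C" using analytic_on_analytic_at by blast
  then show hol: "G holomorphic_on C" by (rule analytic_imp_holomorphic)
  show opC: "open C"
  proof (subst open_subopen, intro ballI)
    fix z assume z: "z \<in> C"
    have "isCont G z" using an[OF z] analytic_at_imp_isCont by blast
    moreover have "z \<in> D" "G z \<in> T" using z by (auto simp: C_def)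
    ultimately obtain U where "open U" "z \<in> U" "\<And>w. w \<in> U \<Longrightarrow> G w \<in> T"
      using T(1) unfolding continuous_at_open by metis
    then show "\<exists>U. open U \<and> z \<in> U \<and> U \<subseteq> C"
      using \<open>z \<in> D\<close> D by (intro exI[of _ "U \<inter> D"]) (auto simp: C_def)
  qed
  show "covering_space C G T"
  proof (rule proper_imp_covering_space[OF opC _ T(1,2) hol])
    show "C \<noteq> {}" "G ` C \<subseteq> T" using z0 by (auto simp: C_def)
    show "deriv G z \<noteq> 0" if "z \<in> C" for z using that G' by (simp add: C_def)
    fix K assume K: "compact K" "K \<subseteq> T"
    have "compact {z\<in>D. G z \<in> K}"
      by (rule boundary_limits_imp_proper[OF D G bd K(1)]) (use K(2) T in auto)
    moreover have "{z\<in>C. G z \<in> K} = {z\<in>D. G z \<in> K}" using K by (auto simp: C_def)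
    ultimately show "compact {z\<in>C. G z \<in> K}" by simp
  qed
qed

text \<open>A convex set is simply connected, so the identity of \<open>T\<close> lifts through the
  covering with the prescribed value over \<open>p z\<close>; the lift inherits holomorphy.\<close>

lemma covering_space_convex_section:
  fixes p :: "complex \<Rightarrow> complex"
  assumes cov: "covering_space C p T" and "open C" "p holomorphic_on C"
    and T: "open T" "convex T" and z: "z \<in> C" "p z \<in> T"
  obtains s where "s holomorphic_on T" "s ` T \<subseteq> C" "s (p z) = z" "\<And>w. w \<in> T \<Longrightarrow> p (s w) = w"
proof -
  obtain s where s: "continuous_on T s" "s \<in> T \<rightarrow> C" "s (p z) = z" "\<And>w. w \<in> T \<Longrightarrow> p (s w) = w"
    using covering_space_lift_strong[OF cov z convex_imp_simply_connected[OF T(2)]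
        open_imp_locally_path_connected[OF T(1)] continuous_on_id, of]
    by auto
  moreover have "s holomorphic_on T"
    by (rule covering_space_lift_is_holomorphic[OF cov \<open>open C\<close> \<open>p holomorphic_on C\<close>, of "\<lambda>w. w"])
       (use s in auto)
  ultimately show ?thesis using that[of s] by blast
qed

subsection \<open>The transforms on truncated cones\<close>

lemma trunc_cone_mono: "a \<le> b \<Longrightarrow> M' \<le> M \<Longrightarrow> trunc_cone a M \<subseteq> trunc_cone b M'"
  unfolding trunc_cone_def by (auto intro: less_le_trans mult_right_mono)

lemma convex_trunc_cone: "convex (trunc_cone a M)"
proof -
  have "trunc_cone a M = {z. inner \<i> z > 0} \<inter> {z. inner \<i> z > M} \<inter>
      {z. inner (Complex 1 (- a)) z < 0} \<inter> {z. inner (Complex (- 1) (- a)) z < 0}"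
    by (auto simp: trunc_cone_def inner_complex_def abs_less_iff)
  then show ?thesis
    by (simp only:) (intro convex_Int convex_halfspace_lt convex_halfspace_gt)
qed

lemma open_trunc_cone: "open (trunc_cone a M)"
  unfolding trunc_cone_def Collect_conj_eq
  by (intro open_Int open_Collect_less continuous_intros)

text \<open>For \<open>a \<le> 1\<close> the norm of \<open>z\<close> is at most
  \<open>2 * Im z\<close>, so \<open>w\<close> is within \<open>Im z / 4\<close> of
  \<open>z\<close>. The height keeps a factor 3/4 and the slope is at most (a + 1/4) / (3/4), which
  is below 2a + 1/2. It is used with \<open>a = 1\<close> (slope 5/2) and \<open>a = 1/4\<close>
  (slope 1).\<close>

lemma trunc_cone_ball:
  assumes z: "z \<in> trunc_cone a (2 * M)" and "0 \<le> a" "a \<le> 1"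
    and w: "dist z w \<le> norm z / 8"
  shows "w \<in> trunc_cone (2 * a + 1 / 2) M" "norm w \<le> 9 / 8 * norm z"
proof -
  show "norm w \<le> 9 / 8 * norm z"
    using w norm_triangle_ineq2[of w z] by (simp add: dist_norm norm_minus_commute)
  have Im: "Im z > 0" "Im z > 2 * M" "\<bar>Re z\<bar> < a * Im z" using z by (auto simp: trunc_cone_def)
  have "a * Im z \<le> Im z" using assms(3) Im by (simp add: mult_left_le_one_le assms(2))
  then have "norm z \<le> 2 * Im z" using cmod_le[of z] Im by linarith
  then have d: "norm (z - w) \<le> Im z / 4" using w by (simp add: dist_norm)
  have "\<bar>Re z - Re w\<bar> \<le> Im z / 4" "\<bar>Im z - Im w\<bar> \<le> Im z / 4"
    using d abs_Re_le_cmod[of "z - w"] abs_Im_le_cmod[of "z - w"] by auto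
  then have Imw: "Im w \<ge> 3 / 4 * Im z" and Rew: "\<bar>Re w\<bar> < a * Im z + Im z / 4"
    using Im(3) by (auto simp: abs_if split: if_splits)
  have "(2 * a + 1 / 2) * Im w \<ge> (2 * a + 1 / 2) * (3 / 4 * Im z)"
    using Imw assms(2) by (intro mult_left_mono) auto
  moreover have "(2 * a + 1 / 2) * (3 / 4 * Im z) \<ge> a * Im z + Im z / 4"
    using Im(1) mult_nonneg_nonneg[OF assms(2), of "Im z"] by (simp add: algebra_simps)
  ultimately show "w \<in> trunc_cone (2 * a + 1 / 2) M"
    using Imw Rew Im by (auto simp: trunc_cone_def)
qed

text \<open>A derivative-free form of closeness to the identity. What matters is that 3/4 is below
  1: this yields injectivity and, for symmetric measures, control of the sign of the real
  part.\<close>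

definition near_identity_on :: "(complex \<Rightarrow> complex) \<Rightarrow> complex set \<Rightarrow> bool" where
  "near_identity_on f S \<longleftrightarrow>
     (\<forall>u\<in>S. \<forall>v\<in>S. norm ((f u - u) - (f v - v)) \<le> norm (u - v) * 3 / 4)"

lemma near_identity_onD:
  "near_identity_on f S \<Longrightarrow> u \<in> S \<Longrightarrow> v \<in> S \<Longrightarrow> norm ((f u - u) - (f v - v)) \<le> norm (u - v) * 3 / 4"
  by (simp add: near_identity_on_def)

lemma near_identity_on_imp_inj_on:
  assumes "near_identity_on f S"
  shows "inj_on f S"
proof (rule inj_onI)
  fix u v assume "u \<in> S" "v \<in> S" "f u = f v"
  then show "u = v"
    using near_identity_onD[OF assms, of u v] by (simp add: norm_minus_commute)
qed

section \<open>Analyticity of the transforms and their behaviour at infinity\<close>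

context real_distribution
begin

lemma integrable_cauchy_kernel:
  assumes "Im z > 0"
  shows "integrable M (\<lambda>x. 1 / (z - complex_of_real x))"
proof (rule integrable_const_bound[of _ "1 / Im z"])
  have "Im z \<le> norm (z - complex_of_real x)" for x
    using abs_Im_le_cmod[of "z - complex_of_real x"] by simp
  then show "AE x in M. norm (1 / (z - complex_of_real x)) \<le> 1 / Im z"
    using assms by (auto simp: norm_divide intro!: frac_le)
qed measurable

lemma cauchy_transform_Im_neg:
  assumes "Im z > 0"
  shows "Im (cauchy_transform M z) < 0"
proof -
  have Im: "Im (1 / (z - complex_of_real x)) < 0" for x
    using assms by (auto simp: Im_divide divide_neg_pos sum_power2_gt_zero_iff)
  have "(LINT x|M. Im (1 / (z - complex_of_real x))) < 0"
    using integrable_cauchy_kernel[OF assms] Im by (intro expectation_less integrable_Im) auto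
  then show ?thesis
    unfolding cauchy_transform_def using integral_Im[OF integrable_cauchy_kernel[OF assms]] by simp
qed

lemma cauchy_transform_nonzero: "Im z > 0 \<Longrightarrow> cauchy_transform M z \<noteq> 0"
  using cauchy_transform_Im_neg[of z] by auto

text \<open>Difference quotients along a sequence are integrals of explicit kernels. After finitely
  many terms are dropped, the imaginary parts stay above \<open>Im z / 2\<close>, which gives a
  constant dominating function.\<close>

lemma cauchy_transform_holomorphic: "cauchy_transform M holomorphic_on upper_half"
proof -
  have "(cauchy_transform M has_field_derivative (LINT x|M. - (1 / (z - complex_of_real x)\<^sup>2))) (at z)"
    if z: "Im z > 0" for z
    unfolding has_field_derivative_iff tendsto_at_iff_sequentially comp_def
  proof (intro allI impI)
    fix w :: "nat \<Rightarrow> complex" assume w: "\<forall>n. w n \<in> UNIV - {z}" "w \<longlonglongrightarrow> z"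
    have "\<forall>\<^sub>F n in sequentially. dist (w n) z < Im z / 2"
      using w(2) z by (intro tendstoD) auto
    then obtain N where N: "\<And>n. n \<ge> N \<Longrightarrow> dist (w n) z < Im z / 2"
      unfolding eventually_sequentially by blast
    have wN: "Im (w (n + N)) \<ge> Im z / 2" for n
      using N[of "n + N"] abs_Im_le_cmod[of "w (n + N) - z"] by (simp add: dist_norm)
    have nz: "norm (z - complex_of_real x) \<ge> Im z" "norm (w (n + N) - complex_of_real x) \<ge> Im z / 2" for n x
      using abs_Im_le_cmod[of "z - complex_of_real x"] wN[of n]
        abs_Im_le_cmod[of "w (n + N) - complex_of_real x"] z by auto
    then have nz0: "z - complex_of_real x \<noteq> 0" "w (n + N) - complex_of_real x \<noteq> 0" for n x
      using z by (metis le_less_trans less_irrefl norm_zero, metis half_gt_zero le_less_trans less_irrefl norm_zero)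
    have "(\<lambda>n. LINT x|M. - (1 / ((w (n + N) - complex_of_real x) * (z - complex_of_real x))))
        \<longlonglongrightarrow> (LINT x|M. - (1 / (z - complex_of_real x)\<^sup>2))"
    proof (rule integral_dominated_convergence[where w = "\<lambda>_. 1 / (Im z / 2 * Im z)"])
      have "(\<lambda>n. w (n + N)) \<longlonglongrightarrow> z" using w(2) by (rule LIMSEQ_ignore_initial_segment)
      then show "AE x in M. (\<lambda>n. - (1 / ((w (n + N) - complex_of_real x) * (z - complex_of_real x))))
          \<longlonglongrightarrow> - (1 / (z - complex_of_real x)\<^sup>2)"
        unfolding power2_eq_square using nz0 by (intro AE_I2 tendsto_intros) auto
      show "AE x in M. norm (- (1 / ((w (n + N) - complex_of_real x) * (z - complex_of_real x))))
          \<le> 1 / (Im z / 2 * Im z)" for n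
        unfolding norm_minus_cancel norm_divide norm_mult norm_one
        using nz z by (intro AE_I2 frac_le mult_mono) auto
    qed (auto intro!: borel_measurable_uminus borel_measurable_divide)
    moreover have "(cauchy_transform M (w (n + N)) - cauchy_transform M z) / (w (n + N) - z)
        = (LINT x|M. - (1 / ((w (n + N) - complex_of_real x) * (z - complex_of_real x))))" for n
    proof -
      have "cauchy_transform M (w (n + N)) - cauchy_transform M z
          = (LINT x|M. 1 / (w (n + N) - complex_of_real x) - 1 / (z - complex_of_real x))"
        unfolding cauchy_transform_def using wN[of n] z
        by (intro Bochner_Integration.integral_diff[symmetric] integrable_cauchy_kernel) auto
      also have "\<dots> = (LINT x|M. (w (n + N) - z) *
          - (1 / ((w (n + N) - complex_of_real x) * (z - complex_of_real x))))"
      proof (intro Bochner_Integration.integral_cong refl)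
        have *: "1 / a - 1 / b = (a - b) * - (1 / (a * b))" if "a \<noteq> 0" "b \<noteq> 0" for a b :: complex
          using that by (simp add: field_simps)
        show "1 / (w (n + N) - complex_of_real x) - 1 / (z - complex_of_real x) = (w (n + N) - z) *
            - (1 / ((w (n + N) - complex_of_real x) * (z - complex_of_real x)))" for x
          using *[OF nz0(2)[of n x] nz0(1)[of x]] by simp
      qed
      also have "\<dots> = (w (n + N) - z) *
          (LINT x|M. - (1 / ((w (n + N) - complex_of_real x) * (z - complex_of_real x))))"
        by (rule integral_mult_right_zero)
      finally show ?thesis using w(1) by simp
    qed
    ultimately have "(\<lambda>n. (cauchy_transform M (w (n + N)) - cauchy_transform M z) / (w (n + N) - z))
        \<longlonglongrightarrow> (LINT x|M. - (1 / (z - complex_of_real x)\<^sup>2))"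
      by simp
    then show "(\<lambda>n. (cauchy_transform M (w n) - cauchy_transform M z) / (w n - z))
        \<longlonglongrightarrow> (LINT x|M. - (1 / (z - complex_of_real x)\<^sup>2))"
      by (rule LIMSEQ_offset)
  qed
  then show ?thesis
    by (intro holomorphic_onI) (auto simp: field_differentiable_def intro: has_field_derivative_at_within)
qed

lemma F_transform_holomorphic: "F_transform M holomorphic_on upper_half"
  unfolding F_transform_def
  using cauchy_transform_nonzero by (intro holomorphic_intros cauchy_transform_holomorphic) auto

lemma cauchy_transform_symmetric:
  assumes "symmetric_measure M"
  shows "cauchy_transform M (- cnj z) = - cnj (cauchy_transform M z)"
proof -
  have "cauchy_transform M (- cnj z)
      = (LINT x|distr M borel uminus. 1 / (- cnj z - complex_of_real x))"
    using assms by (simp add: cauchy_transform_def symmetric_measure_def)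
  also have "\<dots> = (LINT x|M. 1 / (- cnj z - complex_of_real (- x)))"
    by (rule integral_distr) measurable
  also have "\<dots> = (LINT x|M. - cnj (1 / (z - complex_of_real x)))"
  proof -
    have "1 / (- cnj z - complex_of_real (- x)) = - cnj (1 / (z - complex_of_real x))" for x
      using minus_divide_right[of 1 "cnj z - complex_of_real x"] by simp
    then show ?thesis by simp
  qed
  also have "\<dots> = - cnj (cauchy_transform M z)"
    unfolding cauchy_transform_def by (simp only: Bochner_Integration.integral_minus Bochner_Integration.integral_cnj)
  finally show ?thesis .
qed

lemma F_transform_symmetric:
  assumes "symmetric_measure M"
  shows "F_transform M (- cnj z) = - cnj (F_transform M z)"
  by (simp add: F_transform_def cauchy_transform_symmetric[OF assms])

text \<open>\<open>z * G z - 1\<close> is the integral of \<open>x / (z - x)\<close>, and on the cone this integrand is dominated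
  by a function of \<open>x\<close> alone that tends boundedly to 0 as the truncation height grows.\<close>

lemma F_transform_asymptotic:
  assumes "e > 0"
  obtains R where "R > 0" "\<And>z. z \<in> trunc_cone a R \<Longrightarrow> norm (F_transform M z - z) \<le> e * norm z"
proof -
  \<comment> \<open>Two bounds for |x| / |z - x| in one: the aperture gives the constant
    \<open>2 + \<bar>a\<bar>\<close>, which dominates, and the height \<open>Suc n\<close> gives the
    quotient, which tends to 0 pointwise.\<close>
  define b where "b n x = min (2 + \<bar>a\<bar>) (\<bar>x\<bar> / real (Suc n))" for n x
  have "(\<lambda>n. LINT x|M. b n x) \<longlonglongrightarrow> (LINT x|M. (0::real))"
  proof (rule integral_dominated_convergence[where w = "\<lambda>_. 2 + \<bar>a\<bar>"])
    have "(\<lambda>n. b n x) \<longlonglongrightarrow> min (2 + \<bar>a\<bar>) 0" for x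
      unfolding b_def by (intro tendsto_min tendsto_const LIMSEQ_Suc[OF lim_const_over_n])
    then show "AE x in M. (\<lambda>n. b n x) \<longlonglongrightarrow> 0" by simp
  qed (auto simp: b_def)
  then have lim: "(\<lambda>n. LINT x|M. b n x) \<longlonglongrightarrow> 0" by simp
  \<comment> \<open>Below, \<open>F_transform M z\<close> is z / (1 + D) with |D| < d. The bound 1/2
    gives |1 + D| at least 1/2, which at most doubles the error; hence \<open>e / 2\<close>.\<close>
  define d where "d = min (1 / 2) (e / 2)"
  have "d > 0" using assms by (simp add: d_def)
  then obtain n where n: "(LINT x|M. b n x) < d"
    using order_tendstoD(2)[OF lim] eventually_happens trivial_limit_sequentially by blast
  show ?thesis
  proof
    show "real (Suc n) > 0" by simp
    fix z assume "z \<in> trunc_cone a (Suc n)"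
    then have z: "Im z > 0" "Im z > real (Suc n)" "\<bar>Re z\<bar> < a * Im z" by (auto simp: trunc_cone_def)
    have nz: "norm (z - complex_of_real x) \<ge> Im z" for x
      using abs_Im_le_cmod[of "z - complex_of_real x"] by simp
    have nz0: "z - complex_of_real x \<noteq> 0" for x
      using nz[of x] z(1) by auto
    have bound: "norm (complex_of_real x / (z - complex_of_real x)) \<le> b n x" for x
    proof -
      have "a * Im z \<le> \<bar>a\<bar> * Im z" using z(1) by (intro mult_right_mono) auto
      then have "norm z \<le> (1 + \<bar>a\<bar>) * Im z"
        using cmod_le[of z] z unfolding distrib_right by linarith
      also have "\<dots> \<le> (1 + \<bar>a\<bar>) * norm (z - complex_of_real x)"
        using nz by (intro mult_left_mono) auto
      finally have "\<bar>x\<bar> \<le> (2 + \<bar>a\<bar>) * norm (z - complex_of_real x)"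
        using norm_triangle_ineq4[of z "z - complex_of_real x"] by (simp add: algebra_simps)
      then have 1: "\<bar>x\<bar> / norm (z - complex_of_real x) \<le> 2 + \<bar>a\<bar>"
        using nz0[of x] by (simp add: pos_divide_le_eq)
      have 2: "\<bar>x\<bar> / norm (z - complex_of_real x) \<le> \<bar>x\<bar> / real (Suc n)"
        using nz[of x] nz0[of x] z(2) by (intro divide_left_mono mult_pos_pos) auto
      show ?thesis using 1 2 by (simp add: b_def norm_divide)
    qed
    define D where "D = z * cauchy_transform M z - 1"
    have "D = (LINT x|M. z * (1 / (z - complex_of_real x)) - 1)"
      unfolding D_def cauchy_transform_def using integrable_cauchy_kernel[OF z(1)]
      by (subst Bochner_Integration.integral_diff)
         (auto simp: prob_space[unfolded space_eq_univ] simp flip: times_divide_eq_right)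
    also have "\<dots> = (LINT x|M. complex_of_real x / (z - complex_of_real x))"
      using nz0 by (intro Bochner_Integration.integral_cong refl) (simp add: field_simps)
    finally have D: "D = \<dots>" .
    have "norm D \<le> (LINT x|M. norm (complex_of_real x / (z - complex_of_real x)))"
      unfolding D by (rule integral_norm_bound)
    also have "\<dots> \<le> (LINT x|M. b n x)"
    proof (rule integral_mono)
      show "integrable M (b n)"
        by (rule integrable_const_bound[of _ "2 + \<bar>a\<bar>"]) (auto simp: b_def[abs_def])
      show "integrable M (\<lambda>x. norm (complex_of_real x / (z - complex_of_real x)))"
        by (rule integrable_const_bound[of _ "2 + \<bar>a\<bar>"])
           (use bound in \<open>auto simp: b_def intro!: AE_I2\<close>)
    qed (rule bound)
    finally have D: "norm D < d" using n by simp
    have "norm (1 + D) \<ge> 1 / 2"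
      using D norm_triangle_ineq2[of 1 "- D"] by (simp add: d_def)
    then have "1 + D \<noteq> 0" by auto
    moreover have "F_transform M z = z / (1 + D)"
      using z(1) by (auto simp: D_def F_transform_def)
    ultimately have "F_transform M z - z = - (z * D / (1 + D))"
      by (simp add: field_simps)
    then have "norm (F_transform M z - z) = norm z * (norm D / norm (1 + D))"
      by (simp add: norm_mult norm_divide)
    also have "\<dots> \<le> norm z * (d / (1 / 2))"
      using D \<open>d > 0\<close> \<open>norm (1 + D) \<ge> 1 / 2\<close> by (intro mult_left_mono frac_le) auto
    also have "\<dots> \<le> norm z * e" by (intro mult_left_mono) (auto simp: d_def)
    finally show "norm (F_transform M z - z) \<le> e * norm z" by (simp add: mult.commute)
  qed
qed

text \<open>Cauchy's estimate for \<open>F\<close> minus the identity on the disc of radius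
  \<open>norm z / 8\<close>: there the difference is at most (1/18) (9/8) |z| = |z| / 16, so its
  derivative is at most 1/2. The mean value inequality on the convex cone finishes. The wider cone
  of slope 5/2 contains these discs.\<close>

lemma F_transform_near_identity:
  obtains R where "R > 0"
    "\<And>z. z \<in> trunc_cone 1 R \<Longrightarrow> norm (F_transform M z - z) \<le> norm z / 18"
    "near_identity_on (F_transform M) (trunc_cone 1 R)"
proof -
  obtain R where R: "R > 0"
    "\<And>z. z \<in> trunc_cone (5 / 2) R \<Longrightarrow> norm (F_transform M z - z) \<le> 1 / 18 * norm z"
    using F_transform_asymptotic[of "1 / 18" "5 / 2"] by auto
  define f where "f z = F_transform M z - z" for z
  have holf: "f holomorphic_on upper_half"
    unfolding f_def by (intro holomorphic_intros F_transform_holomorphic)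
  have df: "norm (deriv f z) \<le> 3 / 4" if z: "z \<in> trunc_cone 1 (2 * R)" for z
  proof -
    have "z \<noteq> 0" using z by (auto simp: trunc_cone_def)
    have sub: "w \<in> trunc_cone (5 / 2) R" "norm w \<le> 9 / 8 * norm z" if "w \<in> cball z (norm z / 8)" for w
      using trunc_cone_ball[OF z, of w] that by auto
    have "cball z (norm z / 8) \<subseteq> upper_half"
      using sub(1) by (auto simp: trunc_cone_def)
    then have hol: "f holomorphic_on cball z (norm z / 8)"
      using holf holomorphic_on_subset by blast
    have "norm ((deriv ^^ 1) f z) \<le> fact 1 * (norm z / 16) / (norm z / 8) ^ 1"
    proof (rule Cauchy_inequality)
      show "f holomorphic_on ball z (norm z / 8)"
        by (rule holomorphic_on_subset[OF hol]) auto
      show "continuous_on (cball z (norm z / 8)) f"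
        by (rule holomorphic_on_imp_continuous_on[OF hol])
      show "norm (f w) \<le> norm z / 16" if "norm (z - w) = norm z / 8" for w
        using R(2)[of w] sub[of w] that by (auto simp: f_def dist_norm)
    qed (use \<open>z \<noteq> 0\<close> in auto)
    then show ?thesis using \<open>z \<noteq> 0\<close> by (simp add: field_simps)
  qed
  show ?thesis
  proof
    show "2 * R > 0" using R(1) by simp
    show "norm (F_transform M z - z) \<le> norm z / 18" if "z \<in> trunc_cone 1 (2 * R)" for z
      using R trunc_cone_mono[of 1 "5 / 2" R "2 * R"] that by auto
    have "norm (f u - f v) \<le> 3 / 4 * norm (u - v)"
      if uv: "u \<in> trunc_cone 1 (2 * R)" "v \<in> trunc_cone 1 (2 * R)" for u v
    proof (rule field_differentiable_bound[OF convex_trunc_cone _ df uv])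
      fix z assume "z \<in> trunc_cone 1 (2 * R)"
      moreover have "open upper_half" by (simp add: open_halfspace_Im_gt)
      ultimately have "f field_differentiable at z"
        using holomorphic_on_imp_differentiable_at[OF holf] by (auto simp: trunc_cone_def)
      then show "(f has_field_derivative deriv f z) (at z within trunc_cone 1 (2 * R))"
        using DERIV_deriv_iff_field_differentiable has_field_derivative_at_within by blast
    qed
    then show "near_identity_on (F_transform M) (trunc_cone 1 (2 * R))"
      by (simp add: near_identity_on_def f_def mult.commute)
  qed
qed

lemma F_transform_univalent_trunc_cone:
  assumes "near_identity_on (F_transform M) (trunc_cone 1 R)"
  shows "univalent_on (F_transform M) (trunc_cone 1 R)"
proof -
  have "trunc_cone 1 R \<subseteq> upper_half" by (auto simp: trunc_cone_def)
  then show ?thesis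
    unfolding univalent_on_def
    using F_transform_holomorphic holomorphic_on_subset near_identity_on_imp_inj_on[OF assms] by blast
qed

text \<open>A solution of F(u) = z is a fixed point of w -> z - (F(w) - w). Brouwer applies on the
  disc of radius \<open>norm z / 8\<close> around \<open>z\<close>, because F(w) - w is small there;
  slope 1/4 and height \<open>2 * R\<close> keep these discs in the cone of univalence.\<close>

lemma ex_F_inverse_on_cone:
  obtains a R h where "F_inverse_on_cone M a R h"
proof -
  obtain R where R: "R > 0"
    "\<And>z. z \<in> trunc_cone 1 R \<Longrightarrow> norm (F_transform M z - z) \<le> norm z / 18"
    "near_identity_on (F_transform M) (trunc_cone 1 R)"
    using F_transform_near_identity by blast
  have univ: "univalent_on (F_transform M) (trunc_cone 1 R)"
    using R(3) by (rule F_transform_univalent_trunc_cone)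
  have sub: "trunc_cone (1 / 4) (2 * R) \<subseteq> trunc_cone 1 R"
    using R(1) by (intro trunc_cone_mono) auto
  have "\<exists>u\<in>trunc_cone 1 R. F_transform M u = z" if z: "z \<in> trunc_cone (1 / 4) (2 * R)" for z
  proof -
    have "z \<noteq> 0" using z by (auto simp: trunc_cone_def)
    have ball: "w \<in> trunc_cone 1 R" "norm w \<le> 9 / 8 * norm z" if "w \<in> cball z (norm z / 8)" for w
      using trunc_cone_ball[OF z, of w] that by auto
    obtain u where u: "u \<in> cball z (norm z / 8)" "z - (F_transform M u - u) = u"
    proof (rule brouwer_ball[of "norm z / 8" z "\<lambda>w. z - (F_transform M w - w)"])
      have "cball z (norm z / 8) \<subseteq> upper_half"
        using ball(1) by (auto simp: trunc_cone_def)
      then show "continuous_on (cball z (norm z / 8)) (\<lambda>w. z - (F_transform M w - w))"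
        by (intro continuous_intros continuous_on_subset[OF
              holomorphic_on_imp_continuous_on[OF F_transform_holomorphic]])
      have "norm (F_transform M w - w) \<le> norm z / 8" if "w \<in> cball z (norm z / 8)" for w
        using R(2)[OF ball(1)[OF that]] ball(2)[OF that] norm_ge_zero[of z] by linarith
      then show "(\<lambda>w. z - (F_transform M w - w)) \<in> cball z (norm z / 8) \<rightarrow> cball z (norm z / 8)"
        by (auto simp: dist_norm)
    qed (use \<open>z \<noteq> 0\<close> in auto)
    then show ?thesis using ball(1) by (intro bexI[of _ u]) (auto simp: algebra_simps)
  qed
  then obtain h where "\<And>z. z \<in> trunc_cone (1 / 4) (2 * R) \<Longrightarrow>
      h z \<in> trunc_cone 1 R \<and> F_transform M (h z) = z" by metis
  moreover have "univalent_on (F_transform M) (trunc_cone (1 / 4) (2 * R))"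
    using univ sub unfolding univalent_on_def
    by (meson holomorphic_on_subset inj_on_subset)
  ultimately have "F_inverse_on_cone M (1 / 4) (2 * R) h"
    unfolding F_inverse_on_cone_def using R(1) univ
    by (intro conjI exI[of _ 1] exI[of _ R]) auto
  then show ?thesis by (rule that)
qed

text \<open>A symmetric measure makes \<open>F\<close> preserve the imaginary axis, and \<open>F\<close> stretches horizontal
  segments starting there almost isometrically.\<close>

lemma F_transform_Re_pos:
  assumes "symmetric_measure M" and "z \<in> trunc_cone 1 R" "Re z > 0"
    and "near_identity_on (F_transform M) (trunc_cone 1 R)"
  shows "Re (F_transform M z) > 0"
proof -
  define v where "v = Complex 0 (Im z)"
  have v: "v \<in> trunc_cone 1 R" using assms(2) by (auto simp: v_def trunc_cone_def)
  have "- cnj v = v" by (simp add: v_def complex_eq_iff)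
  then have "F_transform M v = - cnj (F_transform M v)"
    using F_transform_symmetric[OF assms(1), of v] by simp
  then have "Re (F_transform M v) = 0" by (simp add: complex_eq_iff)
  moreover have zv: "z - v = complex_of_real (Re z)" by (simp add: v_def complex_eq_iff)
  ultimately have "\<bar>Re (F_transform M z) - Re z\<bar> \<le> Re z * 3 / 4"
    using abs_Re_le_cmod[of "(F_transform M z - z) - (F_transform M v - v)"]
      near_identity_onD[OF assms(4,2) v] assms(3) by (simp add: v_def)
  then show ?thesis using assms(3) by (simp add: abs_if split: if_splits)
qed

text \<open>By the identity theorem, \<open>p\<close> inverts the Cauchy transform on all of the
  upper half-plane. Since \<open>1 / z\<close> is the Cauchy transform at \<open>h z\<close>, the
  map z -> p(1/z) extends \<open>h\<close>; it is univalent because the reciprocal exchanges the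
  half-planes.\<close>

lemma UI_by_continuation:
  assumes p: "univalent_on p lower_half" and V: "open V" "V \<noteq> {}" "V \<subseteq> upper_half"
    and pG: "\<And>z. z \<in> V \<Longrightarrow> p (cauchy_transform M z) = z"
  shows "UI M"
proof -
  have "(p \<circ> cauchy_transform M) holomorphic_on upper_half"
    using p cauchy_transform_Im_neg unfolding univalent_on_def
    by (intro holomorphic_on_compose_gen[OF cauchy_transform_holomorphic]) auto
  moreover obtain z0 where "z0 \<in> V" using V(2) by blast
  ultimately have pGz: "p (cauchy_transform M z) = z" if "Im z > 0" for z
    using analytic_continuation_open[of V upper_half "p \<circ> cauchy_transform M" "\<lambda>z. z" z] V that pG
    by (auto simp: open_halfspace_Im_gt convex_connected convex_halfspace_Im_gt)
  obtain a R h where h: "F_inverse_on_cone M a R h" by (rule ex_F_inverse_on_cone)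
  have inv: "(\<lambda>z. 1 / z) ` upper_half \<subseteq> lower_half"
    by (auto simp: Im_divide divide_neg_pos sum_power2_gt_zero_iff complex_eq_iff)
  have "(\<lambda>z. p (1 / z)) holomorphic_on upper_half"
    using p inv unfolding univalent_on_def
    by (intro holomorphic_on_compose_gen[of "\<lambda>z. 1 / z" upper_half p lower_half, unfolded comp_def]
        holomorphic_intros) auto
  moreover have "inj_on (\<lambda>z. p (1 / z)) upper_half"
  proof (rule inj_onI)
    fix x y assume xy: "x \<in> upper_half" "y \<in> upper_half" "p (1 / x) = p (1 / y)"
    then have "1 / x = 1 / y"
      using p inv unfolding univalent_on_def by (meson image_subset_iff inj_onD)
    then show "x = y" by simp
  qed
  moreover have "p (1 / z) = h z" if "z \<in> trunc_cone a R" for z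
  proof -
    have "Im (h z) > 0" "F_transform M (h z) = z"
      using h that by (auto simp: F_inverse_on_cone_def trunc_cone_def)
    then have "1 / z = cauchy_transform M (h z)"
      unfolding F_transform_def by (metis div_by_1 divide_divide_eq_right mult_1)
    then show ?thesis using pGz[OF \<open>Im (h z) > 0\<close>] by simp
  qed
  ultimately show ?thesis
    unfolding UI_def univalent_on_def using h
    by (intro exI[of _ a] exI[of _ R] exI[of _ h] exI[of _ "\<lambda>z. p (1 / z)"]) simp
qed

end

subsection \<open>Continuation across the imaginary axis\<close>

lemma imag_segment_iff: "z \<in> imag_segment I \<longleftrightarrow> Re z = 0 \<and> Im z \<in> I"
  by (auto simp: imag_segment_def complex_eq_iff image_iff intro!: bexI[of _ "Im z"])

lemma inverse_lower_right_half_iff: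
  "1 / z \<in> lower_half \<inter> right_half \<longleftrightarrow> z \<in> upper_half \<inter> right_half"
  by (cases "z = 0") (auto simp: Re_divide Im_divide sum_power2_gt_zero_iff complex_eq_iff
      zero_less_divide_iff divide_less_0_iff not_sum_power2_lt_zero)

lemma inverse_upper_right_half_iff:
  "1 / z \<in> upper_half \<inter> right_half \<longleftrightarrow> z \<in> lower_half \<inter> right_half"
  using inverse_lower_right_half_iff[of "1 / z"] by simp

lemma lower_right_half: "open (lower_half \<inter> right_half)" "convex (lower_half \<inter> right_half)"
  by (auto intro!: open_Int open_halfspace_Im_lt open_halfspace_Re_gt
      convex_Int convex_halfspace_Im_lt convex_halfspace_Re_gt)

text \<open>Carries the axis condition from the Cauchy transform to \<open>F_transform\<close>. The
  neighbourhood shrinks because \<open>g\<close> may vanish off the axis; on the axis its values are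
  nonzero.\<close>

lemma univalent_around_axis_reciprocal:
  assumes "univalent_around_axis_onto f c (imag_segment {..<0})"
  shows "univalent_around_axis_onto (\<lambda>z. 1 / f z) c (imag_segment {0<..})"
proof -
  obtain U g where U: "open U" "imag_segment {c<..} \<subseteq> U" "univalent_on g U"
      "\<forall>z\<in>U \<inter> upper_half. g z = f z" "g ` imag_segment {c<..} = imag_segment {..<0}"
    using assms unfolding univalent_around_axis_onto_def by blast
  define V where "V = U \<inter> g -` (- {0})"
  have g: "g holomorphic_on U" "inj_on g U" using U(3) by (auto simp: univalent_on_def)
  have "open V" unfolding V_def
    by (intro continuous_open_preimage holomorphic_on_imp_continuous_on g U) auto
  moreover have "imag_segment {c<..} \<subseteq> V"
  proof
    fix z assume z: "z \<in> imag_segment {c<..}"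
    then have "g z \<in> imag_segment {..<0}" using U(5) by blast
    then show "z \<in> V" using z U(2) by (auto simp: V_def imag_segment_iff)
  qed
  moreover have "univalent_on (\<lambda>z. 1 / g z) V"
    unfolding univalent_on_def
  proof
    show "(\<lambda>z. 1 / g z) holomorphic_on V"
      by (intro holomorphic_intros holomorphic_on_subset[OF g(1)]) (auto simp: V_def)
    show "inj_on (\<lambda>z. 1 / g z) V"
      using g(2) by (auto simp: inj_on_def V_def)
  qed
  moreover have "(\<lambda>z. 1 / g z) ` imag_segment {c<..} = imag_segment {0<..}"
  proof -
    have "(\<lambda>w. 1 / w) ` imag_segment {..<0} = imag_segment {0<..}"
    proof
      show "(\<lambda>w. 1 / w) ` imag_segment {..<0} \<subseteq> imag_segment {0<..}"
        by (auto simp: imag_segment_iff Re_divide Im_divide sum_power2_gt_zero_iff divide_neg_pos)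
      show "imag_segment {0<..} \<subseteq> (\<lambda>w. 1 / w) ` imag_segment {..<0}"
      proof
        fix z assume "z \<in> imag_segment {0<..}"
        then have "1 / z \<in> imag_segment {..<0}"
          by (auto simp: imag_segment_iff Re_divide Im_divide sum_power2_gt_zero_iff divide_neg_pos)
        then show "z \<in> (\<lambda>w. 1 / w) ` imag_segment {..<0}"
          by (intro image_eqI[of _ _ "1 / z"]) auto
      qed
    qed
    then show ?thesis using U(5) by (metis (no_types) image_image)
  qed
  ultimately show ?thesis
    unfolding univalent_around_axis_onto_def using U(4)
    by (intro exI[of _ V] exI[of _ "\<lambda>z. 1 / g z"]) (auto simp: V_def)
qed

text \<open>The set of axis points near which \<open>s\<close> and \<open>k\<close> agree is open
  and closed in the negative half-line and contains \<open>t0\<close>, so agreement at one point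
  spreads along the whole axis.\<close>

lemma agree_near_axis:
  assumes s: "s holomorphic_on lower_half \<inter> right_half"
    and W: "open W" "imag_segment {..<0} \<subseteq> W" and k: "k holomorphic_on W"
    and t0: "t0 < 0" "r0 > 0" "\<And>w. w \<in> ball (Complex 0 t0) r0 \<inter> right_half \<Longrightarrow> w \<in> lower_half \<Longrightarrow> s w = k w"
    and t: "t < 0"
  obtains r where "r > 0" "ball (Complex 0 t) r \<subseteq> W"
    "\<And>w. w \<in> ball (Complex 0 t) r \<Longrightarrow> w \<in> lower_half \<Longrightarrow> w \<in> right_half \<Longrightarrow> s w = k w"
proof -
  let ?Q = "lower_half \<inter> right_half"
  define T where "T = {t. t < 0 \<and> (\<exists>r>0. \<forall>w\<in>ball (Complex 0 t) r \<inter> ?Q. s w = k w)}"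
  have dist_axis: "dist (Complex 0 u) (Complex 0 v) = dist u v" for u v
    by (simp add: dist_norm cmod_def)
  have ball_W: "\<exists>r>0. ball (Complex 0 t) r \<subseteq> W" if "t < 0" for t
    using W that open_contains_ball[of W] by (auto simp: imag_segment_iff subset_iff)
  \<comment> \<open>If the disc around \<open>t\<close> reaches a point \<open>u\<close> of
    agreement, the identity theorem on the convex part of this disc in the quadrant carries the
    agreement over.\<close>
  have extend: "\<forall>w\<in>ball (Complex 0 t) r \<inter> ?Q. s w = k w"
    if ext: "ball (Complex 0 t) r \<subseteq> W" "u \<in> T" "dist t u < r" for t r u
  proof
    fix w assume w: "w \<in> ball (Complex 0 t) r \<inter> ?Q"
    obtain d where d: "d > 0" "\<forall>w\<in>ball (Complex 0 u) d \<inter> ?Q. s w = k w" and "u < 0"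
      using ext(2) by (auto simp: T_def)
    let ?B = "ball (Complex 0 u) d \<inter> (ball (Complex 0 t) r \<inter> ?Q)"
    \<comment> \<open>Half the available room, so that \<open>Complex e u\<close>, shifted off the
      axis into the quadrant, lies in both discs.\<close>
    define e where "e = min d (r - dist t u) / 2"
    have e: "e > 0" "e < d" "dist t u + e < r"
      using d(1) ext(3) by (auto simp: e_def min_def field_simps)
    have "dist (Complex 0 u) (Complex e u) = e"
      using e(1) by (simp add: dist_norm cmod_def)
    moreover from this have "dist (Complex 0 t) (Complex e u) \<le> dist t u + e"
      using dist_triangle[of "Complex 0 t" "Complex e u" "Complex 0 u"] by (simp add: dist_axis)
    ultimately have ne: "Complex e u \<in> ?B" using e \<open>u < 0\<close> by auto
    show "s w = k w"
    proof (rule analytic_continuation_open[of ?B "ball (Complex 0 t) r \<inter> ?Q" s k w])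
      show "?B \<noteq> {}" using ne by blast
      show "connected (ball (Complex 0 t) r \<inter> ?Q)"
        by (intro convex_connected convex_Int[OF convex_ball] lower_right_half)
      show "s holomorphic_on ball (Complex 0 t) r \<inter> ?Q" "k holomorphic_on ball (Complex 0 t) r \<inter> ?Q"
        using ext(1) by (auto intro: holomorphic_on_subset[OF s] holomorphic_on_subset[OF k])
      show "open ?B" "open (ball (Complex 0 t) r \<inter> ?Q)"
        by (intro open_Int[OF open_ball] lower_right_half(1))+
    qed (use w d(2) in auto)
  qed
  have "open T" unfolding open_dist
  proof (intro ballI)
    fix t assume t: "t \<in> T"
    then have "t < 0" by (simp add: T_def)
    obtain r where r: "r > 0" "\<forall>w\<in>ball (Complex 0 t) r \<inter> ?Q. s w = k w" using t by (auto simp: T_def)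
    have "u \<in> T" if u: "dist u t < min r (- t)" for u
    proof -
      have "u < 0" using u by (auto simp: dist_norm abs_if split: if_splits)
      moreover have "ball (Complex 0 u) (r - dist u t) \<subseteq> ball (Complex 0 t) r"
        by (rule ball_subset_ball_iff[THEN iffD2]) (simp add: dist_axis)
      moreover have "r - dist u t > 0" using u by simp
      ultimately show ?thesis
        using r(2) unfolding T_def by (intro CollectI conjI exI[of _ "r - dist u t"]) blast+
    qed
    then show "\<exists>e>0. \<forall>u. dist u t < e \<longrightarrow> u \<in> T"
      using r(1) \<open>t < 0\<close> by (intro exI[of _ "min r (- t)"]) auto
  qed
  moreover have "open ({..<0} - T)" unfolding open_dist
  proof (intro ballI)
    fix t assume t: "t \<in> {..<0} - T"
    obtain r where r: "r > 0" "ball (Complex 0 t) r \<subseteq> W" using ball_W t by blast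
    have "u \<in> {..<0} - T" if u: "dist u t < min r (- t)" for u
    proof -
      have "u < 0" using u by (auto simp: dist_norm abs_if split: if_splits)
      moreover have "u \<notin> T"
        using extend[OF r(2), of u] u r(1) t by (auto simp: T_def dist_commute)
      ultimately show ?thesis by simp
    qed
    then show "\<exists>e>0. \<forall>u. dist u t < e \<longrightarrow> u \<in> {..<0} - T"
      using r(1) t by (intro exI[of _ "min r (- t)"]) auto
  qed
  moreover have "t0 \<in> T" using t0 by (auto simp: T_def)
  ultimately have "t \<in> T"
    using connectedD[of "{..<0}" T "{..<0} - T"] t t0(1) by (auto simp: connected_Iio)
  obtain r where r: "r > 0" "ball (Complex 0 t) r \<subseteq> W" using ball_W[OF t] by blast
  have "\<forall>w\<in>ball (Complex 0 t) r \<inter> ?Q. s w = k w"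
    using extend[OF r(2) \<open>t \<in> T\<close>] r(1) by simp
  then show ?thesis by (intro that[OF r]) blast
qed

text \<open>Rotated by \<open>\<i>\<close>, gluing \<open>s\<close> and \<open>k\<close> gives a function to which Schwarz reflection applies;
  the images of the two quadrants and of the axis stay in disjoint regions.\<close>

lemma univalent_reflection:
  assumes s: "univalent_on s (lower_half \<inter> right_half)" "s ` (lower_half \<inter> right_half) \<subseteq> right_half"
    and W: "open W" "imag_segment {..<0} \<subseteq> W" and k: "univalent_on k W"
      "\<And>w. w \<in> imag_segment {..<0} \<Longrightarrow> Re (k w) = 0"
    and t0: "t0 < 0" "r0 > 0" "\<And>w. w \<in> ball (Complex 0 t0) r0 \<inter> right_half \<Longrightarrow> w \<in> lower_half \<Longrightarrow> s w = k w"
  obtains p where "univalent_on p lower_half"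
    "\<And>w. w \<in> lower_half \<inter> right_half \<Longrightarrow> p w = s w"
proof -
  let ?S = "{z. Re z > 0}"
  have hols: "s holomorphic_on lower_half \<inter> right_half" and holk: "k holomorphic_on W"
    using s k by (auto simp: univalent_on_def)
  \<comment> \<open>Multiplication by -i takes the first quadrant to the fourth and the positive
    reals to the negative imaginary axis; the outer factor i makes the axis values real. The second
    branch matters only for \<open>Im z = 0\<close>, since \<open>P\<close> evaluates
    \<open>f\<close> only where \<open>Im\<close> is nonnegative.\<close>
  define f where "f z = (if Im z > 0 then \<i> * s (- \<i> * z) else \<i> * k (- \<i> * z))" for z
  define P where "P z = (if 0 \<le> Im z then f z else cnj (f (cnj z)))" for z
  have openS: "open ?S" by (rule open_halfspace_Re_gt)
  have "(\<lambda>z. \<i> * s (- \<i> * z)) holomorphic_on ?S \<inter> {z. 0 < Im z}"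
    by (intro holomorphic_intros holomorphic_on_compose_gen[OF _ hols, unfolded comp_def]) auto
  then have hol: "f holomorphic_on ?S \<inter> {z. 0 < Im z}"
    by (rule holomorphic_transform) (auto simp: f_def)
  have "continuous_on (?S \<inter> {z. 0 \<le> Im z}) f"
    unfolding continuous_on_eq_continuous_within
  proof
    fix z assume z: "z \<in> ?S \<inter> {z. 0 \<le> Im z}"
    show "continuous (at z within ?S \<inter> {z. 0 \<le> Im z}) f"
    proof (cases "Im z > 0")
      case True
      have "open (?S \<inter> {z. 0 < Im z})" by (intro open_Int openS open_halfspace_Im_gt)
      then have "isCont f z"
        using True z holomorphic_on_imp_continuous_on[OF hol] continuous_on_eq_continuous_at by auto
      then show ?thesis by (rule continuous_at_imp_continuous_at_within)
    next
      \<comment> \<open>At a real point \<open>f\<close> agrees, on the closed upper side, with the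
        continuous function built from \<open>k\<close> alone.\<close>
      case False
      with z have z': "Im z = 0" "Re z > 0" by auto
      have zt: "- \<i> * z = Complex 0 (- Re z)" using z' by (simp add: complex_eq_iff)
      obtain r where r: "r > 0" "ball (Complex 0 (- Re z)) r \<subseteq> W"
        "\<And>w. w \<in> ball (Complex 0 (- Re z)) r \<Longrightarrow> w \<in> lower_half \<Longrightarrow> w \<in> right_half \<Longrightarrow> s w = k w"
        using agree_near_axis[OF hols W holk t0, of "- Re z"] z' by auto
      have dist: "dist (- \<i> * u) (- \<i> * v) = dist u v" for u v
        by (simp add: dist_norm norm_mult norm_minus_commute flip: right_diff_distrib)
      have "isCont k (- \<i> * z)"
        using r(1,2) W(1) holk unfolding zt
        by (metis centre_in_ball continuous_on_eq_continuous_at holomorphic_on_imp_continuous_on subsetD)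
      then have "isCont (\<lambda>z. \<i> * k (- \<i> * z)) z"
        by (intro continuous_intros isCont_o2[of z "\<lambda>z. - \<i> * z" k]) auto
      then have "continuous (at z within ?S \<inter> {z. 0 \<le> Im z}) (\<lambda>z. \<i> * k (- \<i> * z))"
        by (rule continuous_at_imp_continuous_at_within)
      then show ?thesis
      proof (rule continuous_transform_within[OF _ r(1) z])
        fix u assume u: "u \<in> ?S \<inter> {z. 0 \<le> Im z}" "dist u z < r"
        have "- \<i> * u \<in> ball (Complex 0 (- Re z)) r"
          using u(2) dist[of z u] unfolding zt by (simp add: dist_commute)
        then show "\<i> * k (- \<i> * u) = f u"
          using r(3)[of "- \<i> * u"] u(1) by (auto simp: f_def)
      qed
    qed
  qed
  moreover have "f z \<in> \<real>" if "z \<in> ?S" "z \<in> \<real>" for z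
  proof -
    have "Im z = 0" using that by (simp add: complex_is_Real_iff)
    moreover from this have "Re (k (- \<i> * z)) = 0"
      using that by (intro k(2)) (auto simp: imag_segment_iff)
    ultimately show ?thesis by (simp add: f_def complex_is_Real_iff)
  qed
  ultimately have holP: "P holomorphic_on ?S"
    unfolding P_def using openS hol by (intro Schwarz_reflection) auto
  have P_pos: "P z = \<i> * s (- \<i> * z)" "- \<i> * z \<in> lower_half \<inter> right_half" "Im (P z) > 0"
    if "z \<in> ?S" "Im z > 0" for z
  proof -
    show 1: "P z = \<i> * s (- \<i> * z)" using that by (simp add: P_def f_def)
    show "- \<i> * z \<in> lower_half \<inter> right_half" using that by auto
    then have "Re (s (- \<i> * z)) > 0" using s(2) by blast
    then show "Im (P z) > 0" unfolding 1 by simp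
  qed
  have P_zero: "P z = \<i> * k (- \<i> * z)" "- \<i> * z \<in> W" "Im (P z) = 0" if "z \<in> ?S" "Im z = 0" for z
  proof -
    show 1: "P z = \<i> * k (- \<i> * z)" using that by (simp add: P_def f_def)
    have 2: "- \<i> * z \<in> imag_segment {..<0}" using that by (auto simp: imag_segment_iff)
    show "- \<i> * z \<in> W" using 2 W(2) by blast
    show "Im (P z) = 0" unfolding 1 using k(2)[OF 2] by simp
  qed
  have P_neg: "P z = cnj (P (cnj z))" if "Im z < 0" for z
    using that by (simp add: P_def)
  have P_neg': "Im (P z) < 0" if "z \<in> ?S" "Im z < 0" for z
    using P_pos(3)[of "cnj z"] P_neg[OF that(2)] that by simp
  have inj_pos: "u = v" if "u \<in> ?S" "v \<in> ?S" "Im u > 0" "Im v > 0" "P u = P v" for u v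
  proof -
    have "s (- \<i> * u) = s (- \<i> * v)" using that P_pos(1)[of u] P_pos(1)[of v] by simp
    then have "- \<i> * u = - \<i> * v"
      using s(1) P_pos(2)[of u] P_pos(2)[of v] that unfolding univalent_on_def by (metis inj_onD)
    then show "u = v" by simp
  qed
  have injP: "u = v" if uv: "u \<in> ?S" "v \<in> ?S" "P u = P v" for u v
  proof -
    \<comment> \<open>\<open>P\<close> preserves the sign of the imaginary part, so points with
      equal values lie on the same side; injectivity then comes from \<open>s\<close>, from
      \<open>k\<close>, or from \<open>s\<close> by conjugation.\<close>
    have sgn_Im: "sgn (Im (P z)) = sgn (Im z)" if "z \<in> ?S" for z
      using P_pos(3)[OF that] P_zero(3)[OF that] P_neg'[OF that]
      by (cases "Im z" "0 :: real" rule: linorder_cases) auto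
    have "sgn (Im u) = sgn (Im v)" using sgn_Im[OF uv(1)] sgn_Im[OF uv(2)] uv(3) by simp
    then consider "Im u > 0" "Im v > 0" | "Im u = 0" "Im v = 0" | "Im u < 0" "Im v < 0"
      by (auto simp: sgn_if split: if_splits)
    then show ?thesis
    proof cases
      case 1 then show ?thesis using inj_pos uv by blast
    next
      case 2
      then have "k (- \<i> * u) = k (- \<i> * v)" using uv P_zero(1)[of u] P_zero(1)[of v] by simp
      then have "- \<i> * u = - \<i> * v"
        using k(1) P_zero(2)[of u] P_zero(2)[of v] uv 2 unfolding univalent_on_def by (metis inj_onD)
      then show ?thesis by simp
    next
      case 3
      then have "P (cnj u) = P (cnj v)" using uv(3) P_neg by (metis complex_cnj_cancel_iff)
      then have "cnj u = cnj v" using inj_pos[of "cnj u" "cnj v"] uv 3 by simp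
      then show ?thesis by simp
    qed
  qed
  show ?thesis
  proof
    show "univalent_on (\<lambda>w. - \<i> * P (\<i> * w)) lower_half"
      unfolding univalent_on_def
    proof
      show "(\<lambda>w. - \<i> * P (\<i> * w)) holomorphic_on lower_half"
        by (intro holomorphic_intros holomorphic_on_compose_gen[OF _ holP, unfolded comp_def]) auto
      show "inj_on (\<lambda>w. - \<i> * P (\<i> * w)) lower_half"
        using injP[of "\<i> * u" "\<i> * v" for u v] by (auto simp: inj_on_def)
    qed
    show "- \<i> * P (\<i> * w) = s w" if "w \<in> lower_half \<inter> right_half" for w
      using P_pos(1)[of "\<i> * w"] that by simp
  qed
qed

subsection \<open>Extension of the inverse transform\<close>

context real_distribution
begin

text \<open>The section over the lower half-plane is based at \<open>\<i>\<close>, which singles out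
  the sheet containing the upper half-plane. Its injectivity is automatic, as \<open>G\<close> is a
  left inverse.\<close>

lemma condition_A_imp_UI:
  assumes "condition_A M D"
  shows "UI M"
proof -
  obtain G where D: "open D" "upper_half \<subseteq> D" and G: "G nicely_meromorphic_on D"
      "\<And>z. z \<in> upper_half \<Longrightarrow> G z = cauchy_transform M z"
      "\<And>z. z \<in> D \<Longrightarrow> G z \<in> lower_half \<Longrightarrow> deriv G z \<noteq> 0"
      "boundary_limits_in G D (insert None (Some ` (upper_half \<union> \<real>)))"
    using assms unfolding condition_A_def by blast
  have low: "G z \<in> lower_half" if "z \<in> upper_half" for z
    using G(2) cauchy_transform_Im_neg that by simp
  have opl: "open lower_half" "convex lower_half"
    by (auto intro: open_halfspace_Im_lt convex_halfspace_Im_lt)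
  have disj: "insert None (Some ` (upper_half \<union> \<real>)) \<inter> Some ` lower_half = {}"
    by (auto simp: complex_is_Real_iff)
  have i: "\<i> \<in> upper_half" by simp
  then have "\<i> \<in> D" using D by blast
  note cov = boundary_limits_imp_covering_space[OF D(1) G(1,4) opl(1) convex_connected[OF opl(2)]
      _ disj G(3) \<open>\<i> \<in> D\<close> low[OF i], simplified]
  obtain s where s: "s holomorphic_on lower_half" "s ` lower_half \<subseteq> {z\<in>D. G z \<in> lower_half}"
      "s (G \<i>) = \<i>" "\<And>w. w \<in> lower_half \<Longrightarrow> G (s w) = w"
    using covering_space_convex_section[of "{z\<in>D. G z \<in> lower_half}" G lower_half \<i>]
      cov opl low[OF i] \<open>\<i> \<in> D\<close> by auto
  have "inj_on s lower_half" using s(4) by (rule inj_on_inverseI)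
  \<comment> \<open>Both s(G(z)) and z are lifts of \<open>G\<close> on the connected upper
    half-plane through the covering \<open>G\<close>, and they agree at \<open>\<i>\<close>.\<close>
  have "s (G z) = z" if "z \<in> upper_half" for z
  proof (rule covering_space_lift_unique[OF cov(3), of "\<lambda>z. s (G z)" \<i> "\<lambda>z. z" upper_half G z])
    have "G holomorphic_on upper_half"
      using cauchy_transform_holomorphic by (rule holomorphic_transform) (use G(2) in auto)
    then show cG: "continuous_on upper_half G" by (rule holomorphic_on_imp_continuous_on)
    show "continuous_on upper_half (\<lambda>z. s (G z))"
      by (rule continuous_on_compose2[OF holomorphic_on_imp_continuous_on[OF s(1)] cG]) (use low in auto)
    show "connected upper_half" by (intro convex_connected convex_halfspace_Im_gt)
  qed (use low s D that in auto)
  then show ?thesis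
    using s(1) \<open>inj_on s lower_half\<close> G(2) exI[of "\<lambda>z. Im z > 0" \<i>]
    by (intro UI_by_continuation[of s upper_half]) (auto simp: univalent_on_def open_halfspace_Im_gt)
qed

text \<open>The covering argument over the fourth quadrant. The last clause is uniqueness of lifts:
  any continuous local inverse \<open>k\<close> through the same base point coincides with
  \<open>s\<close>. It later ties \<open>s\<close> to the continuation along the axis.\<close>

lemma condition_B_section:
  assumes "condition_B_domain M D"
    and z0: "z0 \<in> upper_half \<inter> right_half" "cauchy_transform M z0 \<in> lower_half \<inter> right_half"
  obtains s where "univalent_on s (lower_half \<inter> right_half)" "s ` (lower_half \<inter> right_half) \<subseteq> D"
    "s (cauchy_transform M z0) = z0"
    "\<And>w. w \<in> lower_half \<inter> right_half \<Longrightarrow> s w \<in> upper_half \<inter> right_half \<Longrightarrow> cauchy_transform M (s w) = w"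
    "\<forall>k H. connected H \<and> H \<subseteq> lower_half \<inter> right_half \<and> continuous_on H k \<and>
      k ` H \<subseteq> upper_half \<inter> right_half \<and> (\<forall>w\<in>H. cauchy_transform M (k w) = w) \<and>
      cauchy_transform M z0 \<in> H \<and> k (cauchy_transform M z0) = z0 \<longrightarrow> (\<forall>w\<in>H. k w = s w)"
proof -
  let ?Q = "lower_half \<inter> right_half"
  obtain G where D: "open D" "upper_half \<inter> right_half \<subseteq> D" and G: "G nicely_meromorphic_on D"
      "\<And>z. z \<in> upper_half \<inter> right_half \<Longrightarrow> G z = cauchy_transform M z"
      "\<And>z. z \<in> D \<Longrightarrow> G z \<in> lower_half \<Longrightarrow> deriv G z \<noteq> 0"
      "boundary_limits_in G D (insert None (Some ` closure (left_half \<union> upper_half)))"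
    using assms unfolding condition_B_domain_def by blast
  have "closure (left_half \<union> upper_half) \<subseteq> - ?Q"
    by (intro closure_minimal closed_Compl lower_right_half) auto
  then have disj: "insert None (Some ` closure (left_half \<union> upper_half)) \<inter> Some ` ?Q = {}"
    by auto
  have G0: "G z0 = cauchy_transform M z0" using G(2) z0(1) by blast
  have z0D: "z0 \<in> D" "G z0 \<in> ?Q" using z0 D(2) G0 by auto
  define C where "C = {z\<in>D. G z \<in> ?Q}"
  have cov: "open C" "G holomorphic_on C" "covering_space C G ?Q"
    unfolding C_def
    by (rule boundary_limits_imp_covering_space[OF D(1) G(1,4) lower_right_half(1)
        convex_connected[OF lower_right_half(2)] _ disj _ z0D]; use G(3) in auto)+
  obtain s where s: "s holomorphic_on ?Q" "s ` ?Q \<subseteq> C" "s (G z0) = z0" "\<And>w. w \<in> ?Q \<Longrightarrow> G (s w) = w"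
    using covering_space_convex_section[OF cov(3,1,2) lower_right_half, of z0] z0D
    by (auto simp: C_def)
  show ?thesis
  proof
    show "univalent_on s ?Q" using s(1) inj_on_inverseI[of ?Q G s] s(4) by (simp add: univalent_on_def)
    show "s ` ?Q \<subseteq> D" using s(2) by (auto simp: C_def)
    show "s (cauchy_transform M z0) = z0" using s(3) G0 by simp
    show "cauchy_transform M (s w) = w" if "w \<in> ?Q" "s w \<in> upper_half \<inter> right_half" for w
      using s(4)[OF that(1)] G(2)[OF that(2)] by simp
    have lift_unique: "k w = s w"
      if H: "connected H" "H \<subseteq> ?Q" "continuous_on H k" "k ` H \<subseteq> upper_half \<inter> right_half"
        "\<forall>w\<in>H. cauchy_transform M (k w) = w" "cauchy_transform M z0 \<in> H"
        "k (cauchy_transform M z0) = z0" "w \<in> H" for k H w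
    proof -
      have Gk: "G (k w) = w" "k w \<in> C" if "w \<in> H" for w
      proof -
        have kw: "k w \<in> upper_half \<inter> right_half" using H(4) that by blast
        then show 1: "G (k w) = w" using G(2)[OF kw] H(5) that by simp
        show "k w \<in> C" using 1 D(2) H(2) kw that by (auto simp: C_def)
      qed
      show ?thesis
      proof (rule covering_space_lift_unique[OF cov(3), of k "cauchy_transform M z0" s H "\<lambda>w. w" w])
        show "k (cauchy_transform M z0) = s (cauchy_transform M z0)" using H(7) s(3) G0 by simp
        show "continuous_on H s"
          using holomorphic_on_imp_continuous_on[OF s(1)] H(2) by (rule continuous_on_subset)
        show "s \<in> H \<rightarrow> C" "k \<in> H \<rightarrow> C" using s(2) H(2) Gk by blast+
        show "x = G (s x)" "x = G (k x)" if "x \<in> H" for x using s(4)[of x] Gk(1)[OF that] H(2) that by (metis subsetD)+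
      qed (use H(1-3,6,8) in auto)
    qed
    show "\<forall>k H. connected H \<and> H \<subseteq> ?Q \<and> continuous_on H k \<and>
      k ` H \<subseteq> upper_half \<inter> right_half \<and> (\<forall>w\<in>H. cauchy_transform M (k w) = w) \<and>
      cauchy_transform M z0 \<in> H \<and> k (cauchy_transform M z0) = z0 \<longrightarrow> (\<forall>w\<in>H. k w = s w)"
    proof (intro allI impI ballI, elim conjE)
      fix k H w
      assume "connected H" "H \<subseteq> ?Q" "continuous_on H k" "k ` H \<subseteq> upper_half \<inter> right_half"
        "\<forall>w\<in>H. cauchy_transform M (k w) = w" "cauchy_transform M z0 \<in> H"
        "k (cauchy_transform M z0) = z0" "w \<in> H"
      then show "k w = s w" by (rule lift_unique)
    qed
  qed
qed

text \<open>Supplies base points for the section: the reciprocal preserves the sign of the real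
  part, so control of \<open>F_transform\<close> suffices.\<close>

lemma cauchy_transform_lower_right:
  assumes "symmetric_measure M" and "z \<in> trunc_cone 1 R" "Re z > 0"
    and "near_identity_on (F_transform M) (trunc_cone 1 R)"
  shows "cauchy_transform M z \<in> lower_half \<inter> right_half"
proof -
  have "Re (F_transform M z) > 0" using assms by (rule F_transform_Re_pos)
  then have "Re (cauchy_transform M z) > 0"
    by (cases "cauchy_transform M z = 0")
       (auto simp: F_transform_def Re_divide zero_less_divide_iff not_sum_power2_lt_zero)
  then show ?thesis using cauchy_transform_Im_neg[of z] assms(2) by (simp add: trunc_cone_def)
qed

text \<open>The required open set is the image of the section \<open>s\<close>, and the extension of
  \<open>F_transform\<close> is the reciprocal of the inverse \<open>q\<close> of \<open>s\<close>;
  the reciprocal map exchanges the first and fourth quadrants.\<close>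

lemma condition_B_imp_UIs:
  assumes sym: "symmetric_measure M" and "condition_B_axis M" and B: "condition_B_domain M D"
  shows "UIs M"
proof -
  let ?Q = "lower_half \<inter> right_half"
  have axis: "\<exists>c\<le>0. univalent_around_axis_onto (F_transform M) c (imag_segment {0<..})"
    using assms(2) univalent_around_axis_reciprocal unfolding condition_B_axis_def F_transform_def[abs_def]
    by blast
  obtain R where R: "R > 0"
    "near_identity_on (F_transform M) (trunc_cone 1 R)"
    by (rule F_transform_near_identity) (rule that)
  obtain a R' h where h: "F_inverse_on_cone M a R' h" by (rule ex_F_inverse_on_cone)
  then have "a > 0" by (simp add: F_inverse_on_cone_def)
  \<comment> \<open>The base point must lie in two cones: the one of \<open>h\<close>, to meet the
    definition of \<open>UIs\<close>, and the one of slope 1, where the sign of the real part is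
    known.\<close>
  define y where "y = max R R' + 1"
  define x where "x = min a 1 * y / 2"
  define z0 where "z0 = Complex x y"
  have y: "y > 0" "y > R" "y > R'" using R(1) by (auto simp: y_def)
  have b: "min a 1 > 0" "min a 1 \<le> a" "min a 1 \<le> 1" using \<open>a > 0\<close> by auto
  have "min a 1 * y > 0" "min a 1 * y \<le> a * y" "min a 1 * y \<le> 1 * y"
    by (intro mult_pos_pos mult_right_mono b y less_imp_le)+
  then have "x > 0" "x < a * y" "x < y" unfolding x_def by linarith+
  then have z0: "z0 \<in> trunc_cone a R'" "z0 \<in> trunc_cone 1 R" "Re z0 > 0"
    using y by (auto simp: trunc_cone_def z0_def)
  have Gz0: "cauchy_transform M z0 \<in> ?Q"
    using sym z0(2,3) R(2) by (rule cauchy_transform_lower_right)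
  have "z0 \<in> upper_half \<inter> right_half" using z0 by (auto simp: trunc_cone_def)
  then obtain s where s: "univalent_on s ?Q" "s ` ?Q \<subseteq> D" "s (cauchy_transform M z0) = z0"
      "\<And>w. w \<in> ?Q \<Longrightarrow> s w \<in> upper_half \<inter> right_half \<Longrightarrow> cauchy_transform M (s w) = w"
    by (rule condition_B_section[OF B _ Gz0]) (rule that)
  have s': "s holomorphic_on ?Q" "inj_on s ?Q" using s(1) by (auto simp: univalent_on_def)
  have DQ: "D \<subseteq> lower_half \<union> right_half" using B by (simp add: condition_B_domain_def)
  obtain q where q: "q holomorphic_on s ` ?Q" "\<And>w. w \<in> ?Q \<Longrightarrow> q (s w) = w"
    by (rule holomorphic_has_inverse[OF s'(1) lower_right_half(1) s'(2)]) (rule that)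
  have bij: "bij_betw (\<lambda>z. 1 / q z) (s ` ?Q) (upper_half \<inter> right_half)"
  proof (rule bij_betw_byWitness[where f' = "\<lambda>z. s (1 / z)"])
    show "\<forall>z\<in>s ` ?Q. s (1 / (1 / q z)) = z" using q(2) by auto
    show "\<forall>z\<in>upper_half \<inter> right_half. 1 / q (s (1 / z)) = z"
    proof
      fix z assume "z \<in> upper_half \<inter> right_half"
      then have "1 / z \<in> ?Q" by (rule inverse_lower_right_half_iff[THEN iffD2])
      then show "1 / q (s (1 / z)) = z" using q(2) by simp
    qed
    show "(\<lambda>z. 1 / q z) ` s ` ?Q \<subseteq> upper_half \<inter> right_half"
    proof (clarify del: IntE IntI)
      fix w assume "w \<in> ?Q"
      then show "1 / q (s w) \<in> upper_half \<inter> right_half"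
        unfolding q(2)[OF \<open>w \<in> ?Q\<close>] by (rule inverse_upper_right_half_iff[THEN iffD2])
    qed
    show "(\<lambda>z. s (1 / z)) ` (upper_half \<inter> right_half) \<subseteq> s ` ?Q"
      by (intro image_subsetI imageI inverse_lower_right_half_iff[THEN iffD2])
  qed
  have opn: "open (s ` ?Q)" by (rule open_mapping_thm3[OF s'(1) lower_right_half(1) s'(2)])
  have sub: "s ` ?Q \<subseteq> lower_half \<union> right_half" using s(2) DQ by blast
  have cone: "\<exists>a R' h. F_inverse_on_cone M a R' h \<and> s ` ?Q \<inter> trunc_cone a R' \<noteq> {}"
  proof -
    have "z0 \<in> s ` ?Q" using s(3) Gz0 by (metis imageI)
    then show ?thesis using z0(1) h by (intro exI conjI) auto
  qed
  have hol: "(\<lambda>z. 1 / q z) holomorphic_on s ` ?Q"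
    using q by (intro holomorphic_intros) auto
  \<comment> \<open>A point of \<open>D\<close> in the upper half-plane has positive real part, and
    there \<open>q\<close> is the Cauchy transform.\<close>
  have ext: "1 / q z = F_transform M z" if z: "z \<in> s ` ?Q \<inter> upper_half" for z
  proof -
    obtain w where w: "w \<in> ?Q" "z = s w" using z by blast
    have "s w \<in> D" using s(2) w(1) by blast
    then have "s w \<in> upper_half \<inter> right_half" using z w(2) DQ by auto
    then show ?thesis using s(4)[OF w(1)] q(2)[OF w(1)] w(2) by (simp add: F_transform_def)
  qed
  show ?thesis
    unfolding UIs_def using sym axis bij opn sub cone hol ext
    by (intro conjI exI[of _ "s ` ?Q"] exI[of _ "\<lambda>z. 1 / q z"]) (assumption | rule ballI)+
qed

text \<open>The inverse \<open>k\<close> of the continuation along the axis gives \<open>s\<close>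
  imaginary boundary values, and \<open>D \<subseteq> right_half\<close> puts the image of
  \<open>s\<close> on one side of the axis, so reflection yields a univalent map on the lower
  half-plane.\<close>

lemma condition_B_right_half_imp_UI:
  assumes sym: "symmetric_measure M" and axis: "condition_B_axis M"
    and B: "condition_B_domain M D" and D: "D \<subseteq> right_half"
  shows "UI M"
proof -
  let ?Q = "lower_half \<inter> right_half"
  obtain R where R: "R > 0"
    "near_identity_on (F_transform M) (trunc_cone 1 R)"
    by (rule F_transform_near_identity) (rule that)
  obtain c where "c \<le> 0" and c: "univalent_around_axis_onto (cauchy_transform M) c (imag_segment {..<0})"
    using axis unfolding condition_B_axis_def by (elim exE conjE) (rule that)
  from c obtain U g where U: "open U" "imag_segment {c<..} \<subseteq> U" "univalent_on g U"
      "\<forall>z\<in>U \<inter> upper_half. g z = cauchy_transform M z"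
      "g ` imag_segment {c<..} = imag_segment {..<0}"
    unfolding univalent_around_axis_onto_def by (elim exE conjE) (rule that)
  have g: "g holomorphic_on U" "inj_on g U" using U(3) by (auto simp: univalent_on_def)
  define W where "W = g ` U"
  have W: "open W" "imag_segment {..<0} \<subseteq> W"
    unfolding W_def using open_mapping_thm3[OF g(1) U(1) g(2)] image_mono[OF U(2), of g] U(5) by auto
  obtain k where k: "k holomorphic_on W" "\<And>z. z \<in> U \<Longrightarrow> k (g z) = z"
    by (rule holomorphic_has_inverse[OF g(1) U(1) g(2), folded W_def]) (rule that)
  have gk: "g (k w) = w" "k w \<in> U" if "w \<in> W" for w using that k(2) by (auto simp: W_def)
  have injk: "inj_on k W" using gk(1) by (rule inj_on_inverseI)
  define z1 where "z1 = Complex 0 (R + 1)"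
  have "z1 \<in> imag_segment {c<..}" using R(1) \<open>c \<le> 0\<close> by (auto simp: z1_def imag_segment_iff)
  then have z1: "z1 \<in> U" "g z1 \<in> imag_segment {..<0}" using U(2,5) by blast+
  define t0 where "t0 = Im (g z1)"
  have t0: "t0 < 0" "g z1 = Complex 0 t0"
    using z1(2) by (auto simp: t0_def imag_segment_iff complex_eq_iff)
  have z1_cone: "z1 \<in> trunc_cone 1 R" using R(1) by (auto simp: z1_def trunc_cone_def)
  \<comment> \<open>On a small disc \<open>k\<close> takes values in the cone, where
    \<open>g\<close> is the Cauchy transform and the sign of its real part is known.\<close>
  have "open (W \<inter> k -` trunc_cone 1 R)"
    by (intro continuous_open_preimage holomorphic_on_imp_continuous_on k W open_trunc_cone)
  moreover have "Complex 0 t0 \<in> W \<inter> k -` trunc_cone 1 R"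
    using z1 z1_cone t0(2) k(2) W(2) by (metis IntI subsetD vimageI2)
  ultimately obtain r where r: "r > 0" "ball (Complex 0 t0) r \<subseteq> W \<inter> k -` trunc_cone 1 R"
    using open_contains_ball by blast
  let ?B = "ball (Complex 0 t0) r"
  have BW: "w \<in> W" "k w \<in> trunc_cone 1 R" if "w \<in> ?B" for w using r(2) that by auto
  have holkB: "k holomorphic_on ?B" and injkB: "inj_on k ?B"
    using BW(1) by (auto intro: holomorphic_on_subset[OF k(1)] inj_on_subset[OF injk])
  have "open (k ` ?B)" by (rule open_mapping_thm3[OF holkB open_ball injkB])
  moreover have "z1 \<in> k ` ?B"
    using k(2)[OF z1(1)] r(1) t0(2) by (metis centre_in_ball imageI)
  ultimately obtain e where e: "e > 0" "ball z1 e \<subseteq> k ` ?B"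
    using open_contains_ball by blast
  \<comment> \<open>A push off the axis to the right, staying in the image of the disc, gives a base
    point shared by \<open>k\<close> and \<open>s\<close>.\<close>
  define z0 where "z0 = z1 + complex_of_real (e / 2)"
  have "z0 \<in> ball z1 e" using e(1) by (simp add: z0_def dist_norm)
  then obtain w0 where w0: "w0 \<in> ?B" "z0 = k w0" using e(2) by blast
  have z0: "Re z0 > 0" "z0 \<in> trunc_cone 1 R"
    using e(1) BW(2)[OF w0(1)] unfolding w0(2)[symmetric] by (simp_all add: z0_def z1_def)
  have cauchy_k: "cauchy_transform M (k w) = w" if "w \<in> ?B" for w
    using bspec[OF U(4), of "k w"] gk[OF BW(1)[OF that]] BW(2)[OF that] by (simp add: trunc_cone_def)
  have Gz0: "cauchy_transform M z0 = w0" using cauchy_k w0 by simp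
  have w0Q: "w0 \<in> ?Q"
    using cauchy_transform_lower_right[OF sym z0(2,1) R(2)] Gz0 by simp
  define H where "H = ?B \<inter> ?Q"
  have H: "open H" "connected H" "H \<subseteq> ?Q" "w0 \<in> H" "H \<subseteq> ?B"
    unfolding H_def using lower_right_half w0 w0Q
    by (auto intro!: open_Int[OF open_ball] convex_connected convex_Int[OF convex_ball] simp del: Int_iff)
  have contk: "continuous_on H k"
    using holomorphic_on_imp_continuous_on[OF holkB] H(5) by (rule continuous_on_subset)
  \<comment> \<open>If \<open>k w\<close> were on the axis, \<open>w = g (k w)\<close> would be too.
    So the real part of \<open>k\<close> never vanishes on the connected set \<open>H\<close>, and
    it is positive at \<open>w0\<close>.\<close>
  have Re0: "Re (k w) \<noteq> 0" if "w \<in> H" for w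
  proof
    assume "Re (k w) = 0"
    moreover have "Im (k w) > 0" using BW(2) H(5) that by (auto simp: trunc_cone_def)
    ultimately have "k w \<in> imag_segment {c<..}" using \<open>c \<le> 0\<close> by (auto simp: imag_segment_iff)
    then have "g (k w) \<in> imag_segment {..<0}" using U(5) by blast
    moreover have "w \<in> W" "Re w > 0" using BW(1) H(3,5) that by blast+
    ultimately show False using gk(1)[of w] by (simp add: imag_segment_iff)
  qed
  have Rek: "Re (k w) > 0" if "w \<in> H" for w
  proof (rule ccontr)
    assume neg: "\<not> Re (k w) > 0"
    have "\<exists>z\<in>k ` H. inner 1 z = (0::real)"
    proof (rule connected_ivt_hyperplane)
      show "connected (k ` H)" by (rule connected_continuous_image[OF contk H(2)])
      show "k w \<in> k ` H" "k w0 \<in> k ` H" using that H(4) by blast+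
      show "inner 1 (k w) \<le> 0" "0 \<le> inner 1 (k w0)"
        using neg z0(1) w0(2) by (simp_all add: inner_complex_def)
    qed
    then show False using Re0 by (auto simp: inner_complex_def)
  qed
  have kH: "k ` H \<subseteq> upper_half \<inter> right_half" using Rek BW(2) H(5) by (auto simp: trunc_cone_def)
  have "z0 \<in> upper_half \<inter> right_half" "cauchy_transform M z0 \<in> ?Q"
    using z0 w0Q Gz0 by (auto simp: trunc_cone_def)
  then obtain s where s: "univalent_on s ?Q" "s ` ?Q \<subseteq> D"
    "\<forall>k H. connected H \<and> H \<subseteq> ?Q \<and> continuous_on H k \<and>
      k ` H \<subseteq> upper_half \<inter> right_half \<and> (\<forall>w\<in>H. cauchy_transform M (k w) = w) \<and>
      cauchy_transform M z0 \<in> H \<and> k (cauchy_transform M z0) = z0 \<longrightarrow> (\<forall>w\<in>H. k w = s w)"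
    by (rule condition_B_section[OF B]) (rule that)
  have sk: "k w = s w" if "w \<in> H" for w
  proof -
    have "\<forall>w\<in>H. cauchy_transform M (k w) = w" using cauchy_k H(5) by blast
    moreover have "cauchy_transform M z0 \<in> H" "k (cauchy_transform M z0) = z0"
      using H(4) Gz0 w0(2) by simp_all
    ultimately have "\<forall>w\<in>H. k w = s w"
      using H(2,3) contk kH by (intro mp[OF spec[OF spec[OF s(3), of k], of H]] conjI)
    then show ?thesis using that by blast
  qed
  have "Re (k w) = 0" if w: "w \<in> imag_segment {..<0}" for w
  proof -
    obtain z where "z \<in> imag_segment {c<..}" "w = g z" using w U(5) by blast
    then show ?thesis using k(2) U(2) by (auto simp: imag_segment_iff)
  qed
  moreover have "s w = k w" if "w \<in> ?B \<inter> right_half" "w \<in> lower_half" for w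
    using sk[of w] that by (simp add: H_def)
  moreover have "univalent_on k W" using k(1) injk by (simp add: univalent_on_def)
  ultimately obtain p where p: "univalent_on p lower_half" "\<And>w. w \<in> ?Q \<Longrightarrow> p w = s w"
    using univalent_reflection[OF s(1) _ W _ _ t0(1) r(1)] s(2) D by blast
  show ?thesis
  proof (rule UI_by_continuation[OF p(1), of "k ` H"])
    show "open (k ` H)"
      by (intro open_mapping_thm3 holomorphic_on_subset[OF holkB] inj_on_subset[OF injkB] H)
    show "k ` H \<noteq> {}" using H(4) by blast
    show "k ` H \<subseteq> upper_half" using kH by blast
    fix z assume "z \<in> k ` H"
    then obtain w where w: "w \<in> H" "z = k w" by blast
    then have "cauchy_transform M z = w" using cauchy_k H(5) by blast
    then show "p (cauchy_transform M z) = z" using p(2)[of w] sk[OF w(1)] H(3) w by auto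
  qed
qed

end

theorem proposition2p9:
  fixes \<mu> :: "real measure"
  assumes "real_distribution \<mu>"
  shows "((\<exists>D. condition_A \<mu> D) \<longrightarrow> UI \<mu>) \<and>
         (symmetric_measure \<mu> \<and> condition_B_axis \<mu> \<and> (\<exists>D. condition_B_domain \<mu> D) \<longrightarrow>
            UIs \<mu> \<and> ((\<exists>D. condition_B_domain \<mu> D \<and> D \<subseteq> right_half) \<longrightarrow> UI \<mu>))"
  using real_distribution.condition_A_imp_UI[OF assms]
    real_distribution.condition_B_imp_UIs[OF assms]
    real_distribution.condition_B_right_half_imp_UI[OF assms]
  by blast

end
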